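(* Let $L_1,\dots,L_n$ be lines in $\mathbb{R}^3$ such that $$d(L_i,L_j):=\min_{x\in L_i,\,y\in L_j}\|x-y\|=1\qquad\text{for all }1\le i<j\le n.$$ Then $n\le 18$.
   Context: $\|\cdot\|$ is the Euclidean norm on $\mathbb{R}^3$; lines are (affine) lines in $\mathbb{R}^3$. *)

theory Defs
  imports "HOL-Analysis.Analysis"
begin

definition is_line :: "(real^3) set \<Rightarrow> bool" where
  "is_line L \<longleftrightarrow> (\<exists>a v. v \<noteq> 0 \<and> L = {a + t *\<^sub>R v | t. True})"

text \<open>Distance between two lines: the minimum of the Euclidean distance over
  pairs of points (for lines this infimum is always attained).\<close>
definition line_dist :: "(real^3) set \<Rightarrow> (real^3) set \<Rightarrow> real" where
  "line_dist L M = Inf {norm (x - y) | x y. x \<in> L \<and> y \<in> M}"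

end

theory Submission
  imports Defs
begin

text \<open>Represent a line by the pair \<open>x = (d, m)\<close> of its unit direction and its moment, a vector of
  \<open>\<real>\<^sup>6\<close>. With \<open>P x y = d \<bullet> m' + m \<bullet> d'\<close> and \<open>G x y = d \<bullet> d'\<close>, two skew lines at distance 1
  satisfy \<open>P\<^sup>2 + G\<^sup>2 = 1\<close>, and the same identity holds for \<open>x = y\<close>. Hence the shifted squares \<open>x \<otimes> x\<close>
  span a totally isotropic subspace of the space of symmetric tensors with an explicit indefinite
  form, and signature considerations bound the number of conditions that the lines impose on
  quadrics: at most 6, 7, 9 for lines whose vectors lie in a subspace of dimension 4, 5, 6.

  Conversely, as in Castelnuovo's lemma, products of two linear forms show that an independent set
  spanning a hyperplane together with an independent set off that hyperplane imposes independent
  conditions on quadrics. Any four of the vectors are independent, so comparing the two bounds gives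
  at most 6 vectors in dimension 4, then at most \<open>9 = 6 + 3\<close> in dimension 5 and
  at most \<open>15 = 9 + 6\<close> in dimension 6.

  If two of the lines are parallel, all directions are parallel to a common plane, and the lines fall into
  three classes of parallel lines.\<close>

section \<open>Second moments of weighted points\<close>

text \<open>An indexed form of linear dependence, since different indices may carry equal vectors;
  in that case the difference of the two equal terms is the relation.\<close>

lemma nontrivial_relation:
  fixes v :: "'i \<Rightarrow> 'a::euclidean_space"
  assumes "finite I" and "card I > DIM('a)"
  obtains c where "\<exists>i\<in>I. c i \<noteq> 0" and "(\<Sum>i\<in>I. c i *\<^sub>R v i) = 0"
proof (cases "inj_on v I")
  case True
  then have "card (v ` I) > DIM('a)"
    using assms by (simp add: card_image)
  then have "dependent (v ` I)"
    using dependent_biggerset by blast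
  then obtain u where u: "\<exists>w\<in>v ` I. u w \<noteq> 0" "(\<Sum>w\<in>v ` I. u w *\<^sub>R w) = 0"
    using assms by (auto simp: dependent_finite)
  then show ?thesis
    using that[of "u \<circ> v"] True by (auto simp: sum.reindex)
next
  case False
  then obtain i j where ij: "i \<in> I" "j \<in> I" "i \<noteq> j" "v i = v j"
    by (auto simp: inj_on_def)
  let ?c = "\<lambda>k. (if k = i then 1 else 0) - (if k = j then 1 else 0) :: real"
  have "(\<Sum>k\<in>I. ?c k *\<^sub>R v k) = v i - v j"
    using ij assms(1) by (simp add: scaleR_left_diff_distrib sum_subtractf if_distrib[of "\<lambda>t. t *\<^sub>R _"] sum.delta cong: if_cong)
  then show ?thesis
    using ij by (intro that[of ?c]) (auto intro!: bexI[of _ i])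
qed

text \<open>The weights may have any sign. These are the values of the tensor \<Sum> c x (x
  \<otimes> x) on pairs of functions.\<close>

definition mom :: "('i \<Rightarrow> real) \<Rightarrow> 'i set \<Rightarrow> ('i \<Rightarrow> real) \<Rightarrow> ('i \<Rightarrow> real) \<Rightarrow> real"
  where "mom c X f g = (\<Sum>x\<in>X. c x * (f x * g x))"

lemma mom_commute: "mom c X f g = mom c X g f"
  by (simp add: mom_def mult.commute)

lemma mom_add: "mom c X f (\<lambda>x. g x + h x) = mom c X f g + mom c X f h"
  by (simp add: mom_def algebra_simps sum.distrib)

lemma mom_scale: "mom c X f (\<lambda>x. a * g x) = a * mom c X f g"
  by (simp add: mom_def algebra_simps sum_distrib_left)

text \<open>Bilinear kernels are encoded as lists of terms \<open>(a, f, g)\<close>, so that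
  concrete kernels expand by simplification. In a product of two such terms the variables
  \<open>x\<close> and \<open>y\<close> separate, which leaves a product of two moments.\<close>

lemma sum_kernel_product:
  "(\<Sum>x\<in>X. \<Sum>y\<in>X. c x * c y * ((\<Sum>(a, f, g)\<leftarrow>A. a * (f x * g y)) * (\<Sum>(b, h, k)\<leftarrow>B. b * (h x * k y)))) =
   (\<Sum>(a, f, g)\<leftarrow>A. \<Sum>(b, h, k)\<leftarrow>B. a * b * (mom c X f h * mom c X g k))"
proof -
  have one: "(\<Sum>x\<in>X. \<Sum>y\<in>X. c x * c y * ((a * (f x * g y)) * (b * (h x * k y)))) =
     a * b * (mom c X f h * mom c X g k)" for a f g b h k
    unfolding mom_def sum_product unfolding sum_distrib_left
    by (intro sum.cong refl) (simp add: algebra_simps)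
  have two: "(\<Sum>x\<in>X. \<Sum>y\<in>X. c x * c y * ((a * (f x * g y)) * (\<Sum>(b, h, k)\<leftarrow>B. b * (h x * k y)))) =
     (\<Sum>(b, h, k)\<leftarrow>B. a * b * (mom c X f h * mom c X g k))" for a f g
  proof (induction B)
    case (Cons z B)
    obtain b h k where "z = (b, h, k)" by (cases z)
    then show ?case
      using Cons one[of a f g b h k] by (simp add: distrib_left sum.distrib)
  qed simp
  show ?thesis
  proof (induction A)
    case (Cons z A)
    obtain a f g where "z = (a, f, g)" by (cases z)
    then show ?case
      using Cons two[of a f g] by (simp add: distrib_right distrib_left sum.distrib)
  qed simp
qed

lemma kernel_identity:
  assumes "\<And>x y. x \<in> X \<Longrightarrow> y \<in> X \<Longrightarrow>
      (\<Sum>(a, f, g)\<leftarrow>A. a * (f x * g y))\<^sup>2 + (\<Sum>(b, h, k)\<leftarrow>B. b * (h x * k y))\<^sup>2 = 1"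
  shows "(\<Sum>(a, f, g)\<leftarrow>A. \<Sum>(b, h, k)\<leftarrow>A. a * b * (mom c X f h * mom c X g k)) +
      (\<Sum>(a, f, g)\<leftarrow>B. \<Sum>(b, h, k)\<leftarrow>B. a * b * (mom c X f h * mom c X g k)) = (sum c X)\<^sup>2"
proof -
  have "(sum c X)\<^sup>2 = (\<Sum>x\<in>X. \<Sum>y\<in>X. c x * c y * 1)"
    by (simp add: power2_eq_square sum_product)
  also have "\<dots> = (\<Sum>x\<in>X. \<Sum>y\<in>X. c x * c y * 
      ((\<Sum>(a, f, g)\<leftarrow>A. a * (f x * g y))\<^sup>2 + (\<Sum>(b, h, k)\<leftarrow>B. b * (h x * k y))\<^sup>2))"
    by (intro sum.cong refl) (simp only: assms)
  finally show ?thesis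
    by (simp add: power2_eq_square distrib_left sum.distrib sum_kernel_product)
qed

text \<open>If the squared entries of two Gram-type matrices add up to the all-ones matrix, then the quadratic
  form \<open>\<Sum> c x c y (P x y\<^sup>2 + G x y\<^sup>2 - 1)\<close> vanishes for all weights \<open>c\<close>. It is an indefinite quadratic
  form in the second moments of the coordinates. In each of the next three lemmas the weights are
  subjected to just enough linear conditions to make this form positive definite in the remaining
  moments, so that these must all be zero.\<close>
lemma moments_vanish_6:
  fixes X :: "'i set" and d1 d2 d3 n1 n2 n3 :: "'i \<Rightarrow> real"
  assumes fin: "finite X" and card: "card X > 9"
    and unit: "\<And>x. x \<in> X \<Longrightarrow> (d1 x)\<^sup>2 + (d2 x)\<^sup>2 + (d3 x)\<^sup>2 = 1"
    and eq: "\<And>x y. x \<in> X \<Longrightarrow> y \<in> X \<Longrightarrow>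
      (d1 x * n1 y + n1 x * d1 y + d2 x * n2 y + n2 x * d2 y + d3 x * n3 y + n3 x * d3 y)\<^sup>2
      + (d1 x * d1 y + d2 x * d2 y + d3 x * d3 y)\<^sup>2 = 1"
  obtains c where "\<exists>x\<in>X. c x \<noteq> 0"
    and "\<forall>f\<in>{d1, d2, d3, n1, n2, n3}. \<forall>g\<in>{d1, d2, d3, n1, n2, n3}. mom c X f g = 0"
proof -
  \<comment> \<open>Let D, N, M be the 3 by 3 matrices of the moments of d with d, n with n, and d
    with n. The kernel identity reads 2 <D, N> + 2 tr(M M) + |D|^2 = (tr D)^2. Three conditions make
    M symmetric, so that tr(M M) = |M|^2, and six set N = 2 D. The left side then contains 5 |D|^2,
    while the right side is at most 3 |D|^2; N = D would only give a tie.\<close>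
  let ?v = "\<lambda>x. (d1 x * n2 x - d2 x * n1 x, d1 x * n3 x - d3 x * n1 x, d2 x * n3 x - d3 x * n2 x,
    n1 x * n1 x - 2 * (d1 x * d1 x), n2 x * n2 x - 2 * (d2 x * d2 x), n3 x * n3 x - 2 * (d3 x * d3 x),
    n1 x * n2 x - 2 * (d1 x * d2 x), n1 x * n3 x - 2 * (d1 x * d3 x), n2 x * n3 x - 2 * (d2 x * d3 x))"
  obtain c where c: "\<exists>x\<in>X. c x \<noteq> 0" and rel: "(\<Sum>x\<in>X. c x *\<^sub>R ?v x) = 0"
    using nontrivial_relation[OF fin, of ?v] card by auto
  define m where "m = mom c X"
  note rel' = rel[unfolded prod_eq_iff fst_sum snd_sum, simplified]
  have 1: "m d1 n2 = m d2 n1" "m d1 n3 = m d3 n1" "m d2 n3 = m d3 n2"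
    "m n1 n1 = 2 * m d1 d1" "m n2 n2 = 2 * m d2 d2" "m n3 n3 = 2 * m d3 d3"
    "m n1 n2 = 2 * m d1 d2" "m n1 n3 = 2 * m d1 d3" "m n2 n3 = 2 * m d2 d3"
    using rel' by (simp_all add: m_def mom_def algebra_simps sum_subtractf sum_distrib_left)
  \<comment> \<open>Unit directions turn the total weight into a moment, the trace of D.\<close>
  have 2: "sum c X = m d1 d1 + m d2 d2 + m d3 d3"
  proof -
    have "sum c X = (\<Sum>x\<in>X. c x * ((d1 x)\<^sup>2 + (d2 x)\<^sup>2 + (d3 x)\<^sup>2))"
      by (intro sum.cong refl) (simp add: unit)
    then show ?thesis
      by (simp add: m_def mom_def distrib_left sum.distrib power2_eq_square)
  qed
  have cm: "m n1 d1 = m d1 n1" "m n2 d1 = m d1 n2" "m n3 d1 = m d1 n3"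
     "m n1 d2 = m d2 n1" "m n2 d2 = m d2 n2" "m n3 d2 = m d2 n3"
     "m n1 d3 = m d3 n1" "m n2 d3 = m d3 n2" "m n3 d3 = m d3 n3"
     "m d2 d1 = m d1 d2" "m d3 d1 = m d1 d3" "m d3 d2 = m d2 d3"
     "m n2 n1 = m n1 n2" "m n3 n1 = m n1 n3" "m n3 n2 = m n2 n3"
    by (simp_all add: m_def mom_commute)
  let ?A = "[(1,d1,n1),(1,n1,d1),(1,d2,n2),(1,n2,d2),(1,d3,n3),(1,n3,d3)] :: (real \<times> ('i \<Rightarrow> real) \<times> ('i \<Rightarrow> real)) list"
  let ?B = "[(1,d1,d1),(1,d2,d2),(1,d3,d3)] :: (real \<times> ('i \<Rightarrow> real) \<times> ('i \<Rightarrow> real)) list"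
  have 0: "(\<Sum>(a, f, g)\<leftarrow>?A. a * (f x * g y))\<^sup>2 + (\<Sum>(b, h, k)\<leftarrow>?B. b * (h x * k y))\<^sup>2 = 1"
    if "x \<in> X" "y \<in> X" for x y
    using eq[OF that] by (simp add: add.assoc)
  have 3: "2 * (m d1 n1)\<^sup>2 + 2 * (m d2 n2)\<^sup>2 + 2 * (m d3 n3)\<^sup>2
      + 4 * (m d2 n1)\<^sup>2 + 4 * (m d3 n1)\<^sup>2 + 4 * (m d3 n2)\<^sup>2
      + 5 * (m d1 d1)\<^sup>2 + 5 * (m d2 d2)\<^sup>2 + 5 * (m d3 d3)\<^sup>2
      + 10 * (m d1 d2)\<^sup>2 + 10 * (m d1 d3)\<^sup>2 + 10 * (m d2 d3)\<^sup>2
      = (m d1 d1 + m d2 d2 + m d3 d3)\<^sup>2"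
    using kernel_identity[of X ?A ?B c, OF 0] unfolding 2
    by (simp add: m_def[symmetric] cm 1 power2_eq_square algebra_simps)
  have "(m d1 d1 + m d2 d2 + m d3 d3)\<^sup>2 \<le> 3 * (m d1 d1)\<^sup>2 + 3 * (m d2 d2)\<^sup>2 + 3 * (m d3 d3)\<^sup>2"
    using zero_le_power2[of "m d1 d1 - m d2 d2"] zero_le_power2[of "m d1 d1 - m d3 d3"]
      zero_le_power2[of "m d2 d2 - m d3 d3"]
    by (simp add: power2_eq_square algebra_simps)
  then have "2 * (m d1 n1)\<^sup>2 + 2 * (m d2 n2)\<^sup>2 + 2 * (m d3 n3)\<^sup>2
      + 4 * (m d2 n1)\<^sup>2 + 4 * (m d3 n1)\<^sup>2 + 4 * (m d3 n2)\<^sup>2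
      + 2 * (m d1 d1)\<^sup>2 + 2 * (m d2 d2)\<^sup>2 + 2 * (m d3 d3)\<^sup>2
      + 10 * (m d1 d2)\<^sup>2 + 10 * (m d1 d3)\<^sup>2 + 10 * (m d2 d3)\<^sup>2 = 0"
    using 3 by (intro antisym) (linarith, simp)
  then have "m d1 n1 = 0" "m d2 n2 = 0" "m d3 n3 = 0" "m d2 n1 = 0" "m d3 n1 = 0"
    "m d3 n2 = 0" "m d1 d1 = 0" "m d2 d2 = 0" "m d3 d3 = 0" "m d1 d2 = 0" "m d1 d3 = 0"
    "m d2 d3 = 0"
    by (simp_all add: add_nonneg_eq_0_iff)
  then have "\<forall>f\<in>{d1, d2, d3, n1, n2, n3}. \<forall>g\<in>{d1, d2, d3, n1, n2, n3}. m f g = 0"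
    by (simp add: 1 cm)
  then show thesis
    using that c by (simp add: m_def)
qed

lemma moments_vanish_5:
  fixes X :: "'i set" and d1 d2 d3 n1 n2 :: "'i \<Rightarrow> real" and b :: real
  assumes fin: "finite X" and card: "card X > 7"
    and unit: "\<And>x. x \<in> X \<Longrightarrow> (d1 x)\<^sup>2 + (d2 x)\<^sup>2 + (d3 x)\<^sup>2 = 1"
    and eq: "\<And>x y. x \<in> X \<Longrightarrow> y \<in> X \<Longrightarrow>
      (d1 x * n1 y + n1 x * d1 y + d2 x * n2 y + n2 x * d2 y + b * (d3 x * d3 y))\<^sup>2
      + (d1 x * d1 y + d2 x * d2 y + d3 x * d3 y)\<^sup>2 = 1"
  obtains c where "\<exists>x\<in>X. c x \<noteq> 0"
    and "\<forall>f\<in>{d1, d2, d3, n1, n2}. \<forall>g\<in>{d1, d2, d3, n1, n2}. mom c X f g = 0"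
proof -
  \<comment> \<open>The three conditions that products with \<open>d3\<close> vanish remove all
    terms with \<open>b\<close> and shorten the trace to two terms. The other four make the
    remaining 2 by 2 block of mixed moments symmetric and set N = D there; now 3 |D|^2 stands
    against at most 2 |D|^2.\<close>
  let ?v = "\<lambda>x. (d1 x * n2 x - d2 x * n1 x, d3 x * n1 x, d3 x * n2 x, d3 x * d3 x,
    n1 x * n1 x - d1 x * d1 x, n2 x * n2 x - d2 x * d2 x, n1 x * n2 x - d1 x * d2 x)"
  obtain c where c: "\<exists>x\<in>X. c x \<noteq> 0" and rel: "(\<Sum>x\<in>X. c x *\<^sub>R ?v x) = 0"
    using nontrivial_relation[OF fin, of ?v] card by auto
  define m where "m = mom c X"
  note rel' = rel[unfolded prod_eq_iff fst_sum snd_sum, simplified]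
  have 1: "m d1 n2 = m d2 n1" "m d3 n1 = 0" "m d3 n2 = 0" "m d3 d3 = 0"
    "m n1 n1 = m d1 d1" "m n2 n2 = m d2 d2" "m n1 n2 = m d1 d2"
    using rel' by (simp_all add: m_def mom_def algebra_simps sum_subtractf sum_distrib_left)
  have 2: "sum c X = m d1 d1 + m d2 d2 + m d3 d3"
  proof -
    have "sum c X = (\<Sum>x\<in>X. c x * ((d1 x)\<^sup>2 + (d2 x)\<^sup>2 + (d3 x)\<^sup>2))"
      by (intro sum.cong refl) (simp add: unit)
    then show ?thesis
      by (simp add: m_def mom_def distrib_left sum.distrib power2_eq_square)
  qed
  have cm: "m n1 d1 = m d1 n1" "m n2 d1 = m d1 n2" "m n1 d2 = m d2 n1" "m n2 d2 = m d2 n2"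
     "m n1 d3 = m d3 n1" "m n2 d3 = m d3 n2" "m n2 n1 = m n1 n2"
     "m d2 d1 = m d1 d2" "m d3 d1 = m d1 d3" "m d3 d2 = m d2 d3"
    by (simp_all add: m_def mom_commute)
  let ?A = "[(1,d1,n1),(1,n1,d1),(1,d2,n2),(1,n2,d2),(b,d3,d3)] :: (real \<times> ('i \<Rightarrow> real) \<times> ('i \<Rightarrow> real)) list"
  let ?B = "[(1,d1,d1),(1,d2,d2),(1,d3,d3)] :: (real \<times> ('i \<Rightarrow> real) \<times> ('i \<Rightarrow> real)) list"
  have 0: "(\<Sum>(a, f, g)\<leftarrow>?A. a * (f x * g y))\<^sup>2 + (\<Sum>(b, h, k)\<leftarrow>?B. b * (h x * k y))\<^sup>2 = 1"
    if "x \<in> X" "y \<in> X" for x y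
    using eq[OF that] by (simp add: add.assoc)
  have 3: "2 * (m d1 n1)\<^sup>2 + 2 * (m d2 n2)\<^sup>2 + 4 * (m d2 n1)\<^sup>2
      + 3 * (m d1 d1)\<^sup>2 + 3 * (m d2 d2)\<^sup>2
      + 6 * (m d1 d2)\<^sup>2 + 2 * (m d1 d3)\<^sup>2 + 2 * (m d2 d3)\<^sup>2
      = (m d1 d1 + m d2 d2)\<^sup>2"
    using kernel_identity[of X ?A ?B c, OF 0] unfolding 2
    by (simp add: m_def[symmetric] cm 1 power2_eq_square algebra_simps)
  have "(m d1 d1 + m d2 d2)\<^sup>2 \<le> 2 * (m d1 d1)\<^sup>2 + 2 * (m d2 d2)\<^sup>2"
    using zero_le_power2[of "m d1 d1 - m d2 d2"]
    by (simp add: power2_eq_square algebra_simps)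
  then have "2 * (m d1 n1)\<^sup>2 + 2 * (m d2 n2)\<^sup>2 + 4 * (m d2 n1)\<^sup>2
      + (m d1 d1)\<^sup>2 + (m d2 d2)\<^sup>2
      + 6 * (m d1 d2)\<^sup>2 + 2 * (m d1 d3)\<^sup>2 + 2 * (m d2 d3)\<^sup>2 = 0"
    using 3 by (intro antisym) (linarith, simp)
  then have "m d1 n1 = 0" "m d2 n2 = 0" "m d2 n1 = 0" "m d1 d1 = 0" "m d2 d2 = 0"
    "m d1 d2 = 0" "m d1 d3 = 0" "m d2 d3 = 0"
    by (simp_all add: add_nonneg_eq_0_iff)
  then have "\<forall>f\<in>{d1, d2, d3, n1, n2}. \<forall>g\<in>{d1, d2, d3, n1, n2}. m f g = 0"
    by (simp add: 1 cm)
  then show thesis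
    using that c by (simp add: m_def)
qed

lemma moments_vanish_4:
  fixes X :: "'i set" and d1 d2 d3 t :: "'i \<Rightarrow> real" and p q r :: real
  assumes fin: "finite X" and card: "card X > 6"
    and unit: "\<And>x. x \<in> X \<Longrightarrow> (d1 x)\<^sup>2 + (d2 x)\<^sup>2 + (d3 x)\<^sup>2 = 1"
    and isotropic: "\<And>x. x \<in> X \<Longrightarrow>
      p * (d1 x)\<^sup>2 + 2 * q * (d1 x * d2 x) + r * (d2 x)\<^sup>2 + 2 * (d3 x * t x) = 0"
    and eq: "\<And>x y. x \<in> X \<Longrightarrow> y \<in> X \<Longrightarrow>
      (p * (d1 x * d1 y) + q * (d1 x * d2 y) + q * (d2 x * d1 y) + r * (d2 x * d2 y)
        + d3 x * t y + t x * d3 y)\<^sup>2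
      + (d1 x * d1 y + d2 x * d2 y + d3 x * d3 y)\<^sup>2 = 1"
  obtains c where "\<exists>x\<in>X. c x \<noteq> 0"
    and "\<forall>f\<in>{d1, d2, d3, t}. \<forall>g\<in>{d1, d2, d3, t}. mom c X f g = 0"
proof -
  \<comment> \<open>The first five conditions kill all terms with \<open>p\<close>,
    \<open>q\<close>, \<open>r\<close>. The sixth turns the product of the moments of
    \<open>(t, t)\<close> and \<open>(d3, d3)\<close> into a square.\<close>
  let ?v = "\<lambda>x. (d1 x * d1 x, d1 x * d2 x, d2 x * d2 x, d1 x * t x, d2 x * t x, t x * t x - d3 x * d3 x)"
  obtain c where c: "\<exists>x\<in>X. c x \<noteq> 0" and rel: "(\<Sum>x\<in>X. c x *\<^sub>R ?v x) = 0"
    using nontrivial_relation[OF fin, of ?v] card by auto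
  define m where "m = mom c X"
  note rel' = rel[unfolded prod_eq_iff fst_sum snd_sum, simplified]
  have 1: "m d1 d1 = 0" "m d1 d2 = 0" "m d2 d2 = 0" "m d1 t = 0" "m d2 t = 0" "m t t = m d3 d3"
    using rel' by (simp_all add: m_def mom_def algebra_simps sum_subtractf sum_distrib_left)
  have 2: "sum c X = m d1 d1 + m d2 d2 + m d3 d3"
  proof -
    have "sum c X = (\<Sum>x\<in>X. c x * ((d1 x)\<^sup>2 + (d2 x)\<^sup>2 + (d3 x)\<^sup>2))"
      by (intro sum.cong refl) (simp add: unit)
    then show ?thesis
      by (simp add: m_def mom_def distrib_left sum.distrib power2_eq_square)
  qed
  \<comment> \<open>Isotropy of the points is a further linear relation between the moments that
    costs no condition on the weights; it kills the moment of \<open>d3\<close> and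
    \<open>t\<close>.\<close>
  have "p * m d1 d1 + 2 * q * m d1 d2 + r * m d2 d2 + 2 * m d3 t =
    (\<Sum>x\<in>X. c x * (p * (d1 x)\<^sup>2 + 2 * q * (d1 x * d2 x) + r * (d2 x)\<^sup>2 + 2 * (d3 x * t x)))"
    by (simp add: m_def mom_def distrib_left sum.distrib power2_eq_square sum_distrib_left ac_simps)
  then have 4: "m d3 t = 0"
    by (simp add: isotropic 1)
  have cm: "m d2 d1 = m d1 d2" "m d3 d1 = m d1 d3" "m d3 d2 = m d2 d3"
     "m t d1 = m d1 t" "m t d2 = m d2 t" "m t d3 = m d3 t"
    by (simp_all add: m_def mom_commute)
  let ?A = "[(p,d1,d1),(q,d1,d2),(q,d2,d1),(r,d2,d2),(1,d3,t),(1,t,d3)] :: (real \<times> ('i \<Rightarrow> real) \<times> ('i \<Rightarrow> real)) list"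
  let ?B = "[(1,d1,d1),(1,d2,d2),(1,d3,d3)] :: (real \<times> ('i \<Rightarrow> real) \<times> ('i \<Rightarrow> real)) list"
  have 0: "(\<Sum>(a, f, g)\<leftarrow>?A. a * (f x * g y))\<^sup>2 + (\<Sum>(b, h, k)\<leftarrow>?B. b * (h x * k y))\<^sup>2 = 1"
    if "x \<in> X" "y \<in> X" for x y
    using eq[OF that] by (simp add: add.assoc)
  have "2 * (m d3 d3)\<^sup>2 + 2 * (m d1 d3)\<^sup>2 + 2 * (m d2 d3)\<^sup>2 = 0"
    using kernel_identity[of X ?A ?B c, OF 0] unfolding 2
    by (simp add: m_def[symmetric] cm 1 4 power2_eq_square algebra_simps)
  then have "m d3 d3 = 0" "m d1 d3 = 0" "m d2 d3 = 0"
    by (simp_all add: add_nonneg_eq_0_iff)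
  then have "\<forall>f\<in>{d1, d2, d3, t}. \<forall>g\<in>{d1, d2, d3, t}. m f g = 0"
    by (simp add: 1 4 cm)
  then show thesis
    using that c by (simp add: m_def)
qed

section \<open>Quadrics through equidistant skew lines\<close>

text \<open>The polar form of the Plucker quadric. On two lines with unit directions it is, up to
  sign, their distance times the sine of their angle.\<close>

definition recip :: "(real^3) \<times> (real^3) \<Rightarrow> (real^3) \<times> (real^3) \<Rightarrow> real"
  where "recip x y = fst x \<bullet> snd y + snd x \<bullet> fst y"

definition skew_equidistant :: "((real^3) \<times> (real^3)) set \<Rightarrow> bool"
  where "skew_equidistant X \<longleftrightarrow>
    (\<forall>x\<in>X. norm (fst x) = 1 \<and> fst x \<bullet> snd x = 0) \<and>
    (\<forall>x\<in>X. \<forall>y\<in>X. x \<noteq> y \<longrightarrow> (fst x \<bullet> fst y)\<^sup>2 < 1 \<and> (recip x y)\<^sup>2 + (fst x \<bullet> fst y)\<^sup>2 = 1)"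

text \<open>Products of two linear forms span the quadratic forms. So for finite \<open>X\<close>
  this says that the points fail to impose independent conditions on quadrics, or that the squares x
  \<otimes> x are linearly dependent as a family.\<close>

definition quad_dependent :: "'a::real_inner set \<Rightarrow> bool"
  where "quad_dependent X \<longleftrightarrow>
    (\<exists>c. (\<exists>x\<in>X. c x \<noteq> 0) \<and> (\<forall>u w. mom c X (\<lambda>x. x \<bullet> u) (\<lambda>x. x \<bullet> w) = 0))"

lemma skew_equidistant_subset: "skew_equidistant X \<Longrightarrow> Y \<subseteq> X \<Longrightarrow> skew_equidistant Y"
  unfolding skew_equidistant_def by blast

lemma skew_equidistant_kernel:
  assumes "skew_equidistant X" "x \<in> X" "y \<in> X"
  shows "(recip x y)\<^sup>2 + (fst x \<bullet> fst y)\<^sup>2 = 1"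
proof (cases "x = y")
  case True
  then show ?thesis
    using assms by (simp add: skew_equidistant_def recip_def norm_eq_1 inner_commute)
qed (use assms in \<open>auto simp: skew_equidistant_def\<close>)

lemma recip_self:
  assumes "skew_equidistant X" "x \<in> X"
  shows "recip x x = 0"
  using assms by (simp add: skew_equidistant_def recip_def inner_commute)

lemma inner_fst_self:
  assumes "skew_equidistant X" "x \<in> X"
  shows "fst x \<bullet> fst x = 1"
  using assms by (simp add: skew_equidistant_def norm_eq_1)

lemma recip_nonzero:
  assumes "skew_equidistant X" "x \<in> X" "y \<in> X" "x \<noteq> y"
  shows "recip x y \<noteq> 0"
  using assms by (force simp: skew_equidistant_def)

lemma recip_commute: "recip x y = recip y x"
  by (simp add: recip_def inner_commute)

lemma recip_add_right: "recip x (y + z) = recip x y + recip x z"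
  by (simp add: recip_def inner_add_right)

lemma recip_scale_right: "recip x (a *\<^sub>R y) = a * recip x y"
  by (simp add: recip_def algebra_simps)

lemma recip_zero_right: "recip x 0 = 0"
  by (simp add: recip_def)

lemma inner_coords: "x \<bullet> y = x $ 1 * y $ 1 + x $ 2 * y $ 2 + x $ 3 * y $ 3" for x y :: "real^3"
  by (simp add: inner_vec_def sum_3)

lemma mom_linear_combination:
  "mom c X g (\<lambda>x. \<Sum>(a, f)\<leftarrow>\<alpha>. a * f x) = (\<Sum>(a, f)\<leftarrow>\<alpha>. a * mom c X g f)"
proof (induction \<alpha>)
  case Nil
  then show ?case by (simp add: mom_def)
next
  case (Cons z \<alpha>)
  obtain a f where "z = (a, f)" by (cases z)
  then show ?case using Cons by (simp add: mom_add mom_scale)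
qed

text \<open>Moments are bilinear, so a family spanning the linear forms suffices for testing. It has
  to span them on \<open>X\<close> only, which allows fewer functions when \<open>X\<close> lies in
  a proper subspace.\<close>

lemma quad_dependentI:
  assumes nz: "\<exists>x\<in>X. c x \<noteq> 0"
    and zero: "\<forall>f\<in>F. \<forall>g\<in>F. mom c X f g = 0"
    and coords: "\<And>u. \<exists>\<alpha>. snd ` set \<alpha> \<subseteq> F \<and> (\<forall>x\<in>X. x \<bullet> u = (\<Sum>(a, f)\<leftarrow>\<alpha>. a * f x))"
  shows "quad_dependent X"
proof -
  have "mom c X (\<lambda>x. x \<bullet> u) (\<lambda>x. x \<bullet> w) = 0" for u w
  proof -
    obtain \<alpha> \<beta> where \<alpha>: "snd ` set \<alpha> \<subseteq> F" "\<forall>x\<in>X. x \<bullet> u = (\<Sum>(a, f)\<leftarrow>\<alpha>. a * f x)"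
      and \<beta>: "snd ` set \<beta> \<subseteq> F" "\<forall>x\<in>X. x \<bullet> w = (\<Sum>(a, f)\<leftarrow>\<beta>. a * f x)"
      using coords by meson
    have half: "mom c X g (\<lambda>x. \<Sum>(a, f)\<leftarrow>\<gamma>. a * f x) = 0"
      if "snd ` set \<gamma> \<subseteq> F" "\<forall>f\<in>F. mom c X g f = 0" for g \<gamma>
    proof -
      have "map (\<lambda>(a, f). a * mom c X g f) \<gamma> = map (\<lambda>_. 0) \<gamma>"
        using that by (intro map_cong refl) (force split: prod.splits)
      then show ?thesis
        unfolding mom_linear_combination by (simp only: sum_list_0)
    qed
    have "mom c X (\<lambda>x. x \<bullet> u) (\<lambda>x. x \<bullet> w)
        = mom c X (\<lambda>x. \<Sum>(a, f)\<leftarrow>\<alpha>. a * f x) (\<lambda>x. \<Sum>(a, f)\<leftarrow>\<beta>. a * f x)"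
      unfolding mom_def using \<alpha>(2) \<beta>(2) by (intro sum.cong refl) simp
    also have "\<dots> = 0"
    proof (rule half[OF \<beta>(1)], rule ballI)
      fix f assume "f \<in> F"
      then have "mom c X f (\<lambda>x. \<Sum>(a, f)\<leftarrow>\<alpha>. a * f x) = 0"
        using zero by (intro half[OF \<alpha>(1)]) auto
      then show "mom c X (\<lambda>x. \<Sum>(a, f)\<leftarrow>\<alpha>. a * f x) f = 0"
        by (subst mom_commute)
    qed
    finally show ?thesis .
  qed
  then show ?thesis
    using nz by (auto simp: quad_dependent_def)
qed

lemma quad_dependent_6:
  assumes X: "skew_equidistant X" and fin: "finite X" and card: "card X > 9"
  shows "quad_dependent X"
proof -
  let ?d = "\<lambda>k x. fst x $ k" and ?n = "\<lambda>k x. snd x $ k"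
  have unit: "(?d 1 x)\<^sup>2 + (?d 2 x)\<^sup>2 + (?d 3 x)\<^sup>2 = 1" if "x \<in> X" for x
    using inner_fst_self[OF X that] by (simp add: inner_coords power2_eq_square)
  have eq: "(?d 1 x * ?n 1 y + ?n 1 x * ?d 1 y + ?d 2 x * ?n 2 y + ?n 2 x * ?d 2 y
        + ?d 3 x * ?n 3 y + ?n 3 x * ?d 3 y)\<^sup>2
      + (?d 1 x * ?d 1 y + ?d 2 x * ?d 2 y + ?d 3 x * ?d 3 y)\<^sup>2 = 1" if "x \<in> X" "y \<in> X" for x y
    using skew_equidistant_kernel[OF X that] by (simp add: inner_coords recip_def algebra_simps)
  obtain c where c: "\<exists>x\<in>X. c x \<noteq> 0" and zero:
    "\<forall>f\<in>{?d 1, ?d 2, ?d 3, ?n 1, ?n 2, ?n 3}. \<forall>g\<in>{?d 1, ?d 2, ?d 3, ?n 1, ?n 2, ?n 3}. mom c X f g = 0"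
    by (rule moments_vanish_6[OF fin card unit eq])
  show ?thesis
  proof (rule quad_dependentI[OF c zero])
    fix u :: "(real^3) \<times> (real^3)"
    let ?\<alpha> = "[(fst u $ 1, ?d 1), (fst u $ 2, ?d 2), (fst u $ 3, ?d 3),
      (snd u $ 1, ?n 1), (snd u $ 2, ?n 2), (snd u $ 3, ?n 3)]"
    show "\<exists>\<alpha>. snd ` set \<alpha> \<subseteq> {?d 1, ?d 2, ?d 3, ?n 1, ?n 2, ?n 3} \<and>
      (\<forall>x\<in>X. x \<bullet> u = (\<Sum>(a, f)\<leftarrow>\<alpha>. a * f x))"
      by (intro exI[of _ ?\<alpha>]) (simp add: inner_prod_def inner_coords algebra_simps)
  qed
qed

section \<open>Coordinates adapted to linear relations between the lines\<close>

lemma isometry_to_third_axis: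
  fixes b :: "real^3"
  assumes "b \<noteq> 0"
  obtains h :: "real^3 \<Rightarrow> real^3" where "\<And>x y. h x \<bullet> h y = x \<bullet> y" "linear h"
    "\<And>x. x \<bullet> b = norm b * h x $ 3"
proof -
  have "norm b = norm (norm b *\<^sub>R axis 3 1 :: real^3)"
    by (simp add: norm_axis_1)
  then obtain h where h: "orthogonal_transformation (h :: real^3 \<Rightarrow> real^3)" "h b = norm b *\<^sub>R (axis 3 1 :: real^3)"
    by (rule orthogonal_transformation_exists)
  have "x \<bullet> b = norm b * h x $ 3" for x
  proof -
    have "x \<bullet> b = h x \<bullet> h b"
      using h(1) by (simp add: orthogonal_transformation_def)
    then show ?thesis
      by (simp add: h(2) inner_axis)
  qed
  then show thesis
    using that[of h] h(1) by (simp add: orthogonal_transformation_def)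
qed

lemma inner_isometry_coords:
  fixes h :: "real^3 \<Rightarrow> real^3"
  assumes "\<And>x y. h x \<bullet> h y = x \<bullet> y"
  shows "x \<bullet> y = h x $ 1 * h y $ 1 + h x $ 2 * h y $ 2 + h x $ 3 * h y $ 3"
  using assms[of x y] by (simp add: inner_coords)

text \<open>For a horizontal line, \<open>d1 * m2 - d2 * m1\<close> is its height, and the
  horizontal part of the moment is this height times the direction turned by a right angle. Hence
  the reciprocal product is the difference of heights times the sine of the angle.\<close>

lemma parallel_planes_algebra:
  fixes d1 d2 m1 m2 e1 e2 n1 n2 :: real
  assumes 1: "d1 * d1 + d2 * d2 = 1" "e1 * e1 + e2 * e2 = 1"
    and 2: "d1 * m1 + d2 * m2 = 0" "e1 * n1 + e2 * n2 = 0"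
    and 3: "(d1 * n1 + d2 * n2 + m1 * e1 + m2 * e2)\<^sup>2 + (d1 * e1 + d2 * e2)\<^sup>2 = 1"
    and 4: "(d1 * e1 + d2 * e2)\<^sup>2 < 1"
  shows "((d1 * m2 - d2 * m1) - (e1 * n2 - e2 * n1))\<^sup>2 = 1"
proof -
  define k where "k = d1 * m2 - d2 * m1"
  define l where "l = e1 * n2 - e2 * n1"
  have m: "m1 = - k * d2" "m2 = k * d1" "n1 = - l * e2" "n2 = l * e1"
    using 1 2 unfolding k_def l_def by algebra+
  have 5: "(d1 * e1 + d2 * e2)\<^sup>2 + (d1 * e2 - d2 * e1)\<^sup>2 = 1"
    using 1 by algebra
  have "d1 * n1 + d2 * n2 + m1 * e1 + m2 * e2 = (k - l) * (d1 * e2 - d2 * e1)"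
    unfolding m by algebra
  then have "(k - l)\<^sup>2 * (d1 * e2 - d2 * e1)\<^sup>2 = (d1 * e2 - d2 * e1)\<^sup>2"
    using 3 5 by (simp only: power_mult_distrib)
  moreover have "(d1 * e2 - d2 * e1)\<^sup>2 \<noteq> 0"
    using 4 5 by linarith
  ultimately show ?thesis
    by (simp add: k_def l_def)
qed

text \<open>Skew lines parallel to a common plane lie in parallel planes at mutual distance 1, so there
  are at most two of them.\<close>
lemma directions_not_coplanar:
  assumes X: "skew_equidistant X" and card: "card X \<ge> 3" and b: "b \<noteq> 0"
  shows "\<exists>x\<in>X. fst x \<bullet> b \<noteq> 0"
proof (rule ccontr)
  assume "\<not> ?thesis"
  then have perp: "fst x \<bullet> b = 0" if "x \<in> X" for x
    using that by blast
  obtain h :: "real^3 \<Rightarrow> real^3" where iso: "\<And>x y. h x \<bullet> h y = x \<bullet> y" and third: "\<And>x. x \<bullet> b = norm b * h x $ 3"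
    using isometry_to_third_axis[OF b] by metis
  define height where "height x = h (fst x) $ 1 * h (snd x) $ 2 - h (fst x) $ 2 * h (snd x) $ 1" for x
  have height_diff: "(height x - height y)\<^sup>2 = 1" if "x \<in> X" "y \<in> X" "x \<noteq> y" for x y
  proof -
    note inner = inner_isometry_coords[of h, OF iso]
    have z: "h (fst x) $ 3 = 0" "h (fst y) $ 3 = 0"
      using perp third b that by auto
    have lt: "(fst x \<bullet> fst y)\<^sup>2 < 1"
      using X that by (simp add: skew_equidistant_def)
    show ?thesis
      unfolding height_def
    proof (rule parallel_planes_algebra)
      show "h (fst x) $ 1 * h (fst x) $ 1 + h (fst x) $ 2 * h (fst x) $ 2 = 1"
        "h (fst y) $ 1 * h (fst y) $ 1 + h (fst y) $ 2 * h (fst y) $ 2 = 1"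
        using inner_fst_self[OF X that(1)] inner_fst_self[OF X that(2)] by (simp_all add: inner z)
      show "h (fst x) $ 1 * h (snd x) $ 1 + h (fst x) $ 2 * h (snd x) $ 2 = 0"
        "h (fst y) $ 1 * h (snd y) $ 1 + h (fst y) $ 2 * h (snd y) $ 2 = 0"
        using X that by (auto simp: inner z skew_equidistant_def)
      show "(h (fst x) $ 1 * h (snd y) $ 1 + h (fst x) $ 2 * h (snd y) $ 2
          + h (snd x) $ 1 * h (fst y) $ 1 + h (snd x) $ 2 * h (fst y) $ 2)\<^sup>2
          + (h (fst x) $ 1 * h (fst y) $ 1 + h (fst x) $ 2 * h (fst y) $ 2)\<^sup>2 = 1"
        using skew_equidistant_kernel[OF X that(1,2)] by (simp add: inner z recip_def add.assoc)
      show "(h (fst x) $ 1 * h (fst y) $ 1 + h (fst x) $ 2 * h (fst y) $ 2)\<^sup>2 < 1"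
        using lt by (simp add: inner z)
    qed
  qed
  \<comment> \<open>No three reals have all their differences equal to 1 or -1.\<close>
  obtain T where "T \<subseteq> X" "card T = 3"
    using obtain_subset_with_card_n[OF card] by metis
  moreover from this obtain x y z where "T = {x, y, z}" "x \<noteq> y" "y \<noteq> z" "x \<noteq> z"
    unfolding card_3_iff by metis
  ultimately show False
    using height_diff[of x y] height_diff[of y z] height_diff[of x z]
    by (simp add: power2_eq_1_iff) linarith
qed

text \<open>Since the directions are not coplanar, \<open>snd r\<close> is nonzero. Once it lies on
  the third axis, the relation expresses the third moment coordinate through the direction, and five
  coordinates remain.\<close>

lemma quad_dependent_5:
  assumes X: "skew_equidistant X" and fin: "finite X" and card: "card X > 7"
    and r: "r \<noteq> 0" "\<And>x. x \<in> X \<Longrightarrow> x \<bullet> r = 0"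
  shows "quad_dependent X"
proof -
  have "snd r \<noteq> 0"
  proof
    assume "snd r = 0"
    then have "fst r \<noteq> 0" "\<forall>x\<in>X. fst x \<bullet> fst r = 0"
      using r by (auto simp: prod_eq_iff inner_prod_def)
    then show False
      using directions_not_coplanar[OF X] card by fastforce
  qed
  then obtain h :: "real^3 \<Rightarrow> real^3" where iso: "\<And>x y. h x \<bullet> h y = x \<bullet> y" and third: "\<And>x. x \<bullet> snd r = norm (snd r) * h x $ 3"
    using isometry_to_third_axis by metis
  note inner = inner_isometry_coords[of h, OF iso]
  define N where "N = norm (snd r)"
  define \<beta> where "\<beta> k = - h (fst r) $ k * inverse N" for k
  have m3: "h (snd x) $ 3 = \<beta> 1 * h (fst x) $ 1 + \<beta> 2 * h (fst x) $ 2 + \<beta> 3 * h (fst x) $ 3"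
    if "x \<in> X" for x
  proof -
    have "h (fst x) $ 1 * h (fst r) $ 1 + h (fst x) $ 2 * h (fst r) $ 2 + h (fst x) $ 3 * h (fst r) $ 3
        + N * h (snd x) $ 3 = 0"
      using r(2)[OF that] unfolding inner_prod_def third N_def by (simp add: inner)
    moreover have "inverse N * N = 1"
      using \<open>snd r \<noteq> 0\<close> by (simp add: N_def)
    ultimately show ?thesis
      unfolding \<beta>_def by algebra
  qed
  \<comment> \<open>The shift in \<open>?n\<close> absorbs the mixed terms of the reciprocal product
    that come from \<open>\<beta> 1\<close> and \<open>\<beta> 2\<close>; only the coefficient
    \<open>2 * \<beta> 3\<close> survives.\<close>
  let ?d = "\<lambda>k x. h (fst x) $ k" and ?n = "\<lambda>k x. h (snd x) $ k + \<beta> k * h (fst x) $ 3"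
  have unit: "(?d 1 x)\<^sup>2 + (?d 2 x)\<^sup>2 + (?d 3 x)\<^sup>2 = 1" if "x \<in> X" for x
    using inner_fst_self[OF X that] by (simp add: inner power2_eq_square)
  have eq: "(?d 1 x * ?n 1 y + ?n 1 x * ?d 1 y + ?d 2 x * ?n 2 y + ?n 2 x * ?d 2 y
        + (2 * \<beta> 3) * (?d 3 x * ?d 3 y))\<^sup>2
      + (?d 1 x * ?d 1 y + ?d 2 x * ?d 2 y + ?d 3 x * ?d 3 y)\<^sup>2 = 1" if "x \<in> X" "y \<in> X" for x y
  proof -
    have "recip x y = ?d 1 x * ?n 1 y + ?n 1 x * ?d 1 y + ?d 2 x * ?n 2 y + ?n 2 x * ?d 2 y
        + (2 * \<beta> 3) * (?d 3 x * ?d 3 y)"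
      by (simp add: recip_def inner m3 that algebra_simps)
    moreover have "fst x \<bullet> fst y = ?d 1 x * ?d 1 y + ?d 2 x * ?d 2 y + ?d 3 x * ?d 3 y"
      by (simp add: inner)
    ultimately show ?thesis
      using skew_equidistant_kernel[OF X that] by metis
  qed
  obtain c where c: "\<exists>x\<in>X. c x \<noteq> 0" and zero:
    "\<forall>f\<in>{?d 1, ?d 2, ?d 3, ?n 1, ?n 2}. \<forall>g\<in>{?d 1, ?d 2, ?d 3, ?n 1, ?n 2}. mom c X f g = 0"
    by (rule moments_vanish_5[OF fin card unit eq])
  show ?thesis
  proof (rule quad_dependentI[OF c zero])
    fix u :: "(real^3) \<times> (real^3)"
    let ?u = "\<lambda>k. h (fst u) $ k" and ?w = "\<lambda>k. h (snd u) $ k"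
    let ?\<alpha> = "[(?u 1 + ?w 3 * \<beta> 1, ?d 1), (?u 2 + ?w 3 * \<beta> 2, ?d 2),
      (?u 3 + ?w 3 * \<beta> 3 - ?w 1 * \<beta> 1 - ?w 2 * \<beta> 2, ?d 3), (?w 1, ?n 1), (?w 2, ?n 2)]"
    show "\<exists>\<alpha>. snd ` set \<alpha> \<subseteq> {?d 1, ?d 2, ?d 3, ?n 1, ?n 2} \<and>
      (\<forall>x\<in>X. x \<bullet> u = (\<Sum>(a, f)\<leftarrow>\<alpha>. a * f x))"
      by (intro exI[of _ ?\<alpha>]) (simp add: inner_prod_def inner m3 algebra_simps)
  qed
qed

text \<open>A combination of \<open>r\<close> and \<open>s\<close> with zero second component would
  make the directions coplanar, so already \<open>snd r\<close> and \<open>snd s\<close> are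
  independent, and two moment coordinates can be eliminated.\<close>

lemma quad_dependent_4:
  assumes X: "skew_equidistant X" and fin: "finite X" and card: "card X > 6"
    and indep: "\<And>\<alpha> \<beta>. \<alpha> *\<^sub>R r + \<beta> *\<^sub>R s = 0 \<Longrightarrow> \<alpha> = 0 \<and> \<beta> = 0"
    and r: "\<And>x. x \<in> X \<Longrightarrow> x \<bullet> r = 0" and s: "\<And>x. x \<in> X \<Longrightarrow> x \<bullet> s = 0"
  shows "quad_dependent X"
proof -
  have snd_indep: "\<alpha> = 0 \<and> \<beta> = 0" if "\<alpha> *\<^sub>R snd r + \<beta> *\<^sub>R snd s = 0" for \<alpha> \<beta>
  proof -
    let ?q = "\<alpha> *\<^sub>R r + \<beta> *\<^sub>R s"
    have "fst x \<bullet> fst ?q = 0" if "x \<in> X" for x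
    proof -
      have "x \<bullet> ?q = 0"
        using r[OF that] s[OF that] by (simp add: inner_add_right)
      then show ?thesis
        using \<open>\<alpha> *\<^sub>R snd r + \<beta> *\<^sub>R snd s = 0\<close> by (simp add: inner_prod_def)
    qed
    then have "fst ?q = 0"
      using directions_not_coplanar[OF X, of "fst ?q"] card by fastforce
    then show ?thesis
      using that indep by (simp add: prod_eq_iff)
  qed
  \<comment> \<open>With a common normal of \<open>snd r\<close> and \<open>snd s\<close> on the
    third axis, the two relations involve only the first two moment coordinates.\<close>
  have "dim {snd r, snd s} < DIM(real^3)"
    using dim_le_card'[of "{snd r, snd s}"] by (simp add: card_insert_if split: if_splits)
  then obtain b where "b \<noteq> 0" and b: "\<forall>y\<in>{snd r, snd s}. orthogonal b y"
    by (meson orthogonal_to_subspace_exists span_base)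
  then obtain h :: "real^3 \<Rightarrow> real^3" where iso: "\<And>x y. h x \<bullet> h y = x \<bullet> y" and "linear h"
      and third: "\<And>x. x \<bullet> b = norm b * h x $ 3"
    using isometry_to_third_axis by metis
  note inner = inner_isometry_coords[of h, OF iso]
  define \<rho> where "\<rho> = h (snd r)"
  define \<sigma> where "\<sigma> = h (snd s)"
  have \<rho>3: "\<rho> $ 3 = 0" and \<sigma>3: "\<sigma> $ 3 = 0"
    using b third[of "snd r"] third[of "snd s"] \<open>b \<noteq> 0\<close> by (auto simp: \<rho>_def \<sigma>_def orthogonal_def inner_commute)
  have h_indep: "\<alpha> = 0 \<and> \<beta> = 0" if "\<alpha> *\<^sub>R \<rho> + \<beta> *\<^sub>R \<sigma> = 0" for \<alpha> \<beta>
  proof -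
    have "h (\<alpha> *\<^sub>R snd r + \<beta> *\<^sub>R snd s) = 0"
      using that \<open>linear h\<close> by (simp add: \<rho>_def \<sigma>_def linear_add linear_scale)
    then have "\<alpha> *\<^sub>R snd r + \<beta> *\<^sub>R snd s = 0"
      by (metis iso inner_eq_zero_iff)
    then show ?thesis
      by (rule snd_indep)
  qed
  define \<Delta> where "\<Delta> = \<rho> $ 1 * \<sigma> $ 2 - \<rho> $ 2 * \<sigma> $ 1"
  have "\<Delta> \<noteq> 0"
  proof
    assume "\<Delta> = 0"
    then have "\<sigma> $ 1 *\<^sub>R \<rho> + (- \<rho> $ 1) *\<^sub>R \<sigma> = 0" "\<sigma> $ 2 *\<^sub>R \<rho> + (- \<rho> $ 2) *\<^sub>R \<sigma> = 0"
      by (simp_all add: vec_eq_iff forall_3 \<Delta>_def \<rho>3 \<sigma>3 algebra_simps)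
    then have "\<rho> $ 1 = 0" "\<rho> $ 2 = 0"
      using h_indep[of "\<sigma> $ 1" "- \<rho> $ 1"] h_indep[of "\<sigma> $ 2" "- \<rho> $ 2"] by simp_all
    then have "\<rho> = 0"
      by (simp add: vec_eq_iff forall_3 \<rho>3)
    then show False
      using h_indep[of 1 0] by simp
  qed
  \<comment> \<open>Cramer's rule for these two coordinates in terms of the direction.\<close>
  define a where "a k = (- \<sigma> $ 2 * h (fst r) $ k + \<rho> $ 2 * h (fst s) $ k) * inverse \<Delta>" for k
  define a' where "a' k = (\<sigma> $ 1 * h (fst r) $ k - \<rho> $ 1 * h (fst s) $ k) * inverse \<Delta>" for k
  let ?d = "\<lambda>k x. h (fst x) $ k"
  have m: "h (snd x) $ 1 = a 1 * ?d 1 x + a 2 * ?d 2 x + a 3 * ?d 3 x"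
     "h (snd x) $ 2 = a' 1 * ?d 1 x + a' 2 * ?d 2 x + a' 3 * ?d 3 x" if "x \<in> X" for x
  proof -
    let ?R = "?d 1 x * h (fst r) $ 1 + ?d 2 x * h (fst r) $ 2 + ?d 3 x * h (fst r) $ 3"
    let ?S = "?d 1 x * h (fst s) $ 1 + ?d 2 x * h (fst s) $ 2 + ?d 3 x * h (fst s) $ 3"
    have 1: "?R + h (snd x) $ 1 * \<rho> $ 1 + h (snd x) $ 2 * \<rho> $ 2 = 0"
      using r[OF that] by (simp add: inner_prod_def inner \<rho>_def[symmetric] \<rho>3)
    have 2: "?S + h (snd x) $ 1 * \<sigma> $ 1 + h (snd x) $ 2 * \<sigma> $ 2 = 0"
      using s[OF that] by (simp add: inner_prod_def inner \<sigma>_def[symmetric] \<sigma>3)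
    have "h (snd x) $ 1 * \<Delta> = - \<sigma> $ 2 * ?R + \<rho> $ 2 * ?S" "h (snd x) $ 2 * \<Delta> = \<sigma> $ 1 * ?R - \<rho> $ 1 * ?S"
      using 1 2 unfolding \<Delta>_def by algebra+
    moreover have "inverse \<Delta> * \<Delta> = 1"
      using \<open>\<Delta> \<noteq> 0\<close> by simp
    ultimately show "h (snd x) $ 1 = a 1 * ?d 1 x + a 2 * ?d 2 x + a 3 * ?d 3 x"
        "h (snd x) $ 2 = a' 1 * ?d 1 x + a' 2 * ?d 2 x + a' 3 * ?d 3 x"
      unfolding a_def a'_def by algebra+
  qed
  \<comment> \<open>\<open>?t\<close> absorbs the products of the third direction coordinate with
    the first two. What remains is a binary form in \<open>?d 1\<close>, \<open>?d 2\<close> and a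
    hyperbolic pair \<open>?d 3\<close>, \<open>?t\<close>.\<close>
  let ?t = "\<lambda>x. h (snd x) $ 3 + a 3 * ?d 1 x + a' 3 * ?d 2 x"
  have recip: "recip x y = (2 * a 1) * (?d 1 x * ?d 1 y) + (a 2 + a' 1) * (?d 1 x * ?d 2 y)
      + (a 2 + a' 1) * (?d 2 x * ?d 1 y) + (2 * a' 2) * (?d 2 x * ?d 2 y)
      + ?d 3 x * ?t y + ?t x * ?d 3 y" if "x \<in> X" "y \<in> X" for x y
    by (simp add: recip_def inner m that algebra_simps)
  have unit: "(?d 1 x)\<^sup>2 + (?d 2 x)\<^sup>2 + (?d 3 x)\<^sup>2 = 1" if "x \<in> X" for x
    using inner_fst_self[OF X that] by (simp add: inner power2_eq_square)
  have isotropic: "(2 * a 1) * (?d 1 x)\<^sup>2 + 2 * (a 2 + a' 1) * (?d 1 x * ?d 2 x)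
      + (2 * a' 2) * (?d 2 x)\<^sup>2 + 2 * (?d 3 x * ?t x) = 0" if "x \<in> X" for x
    using recip_self[OF X that] unfolding recip[OF that that]
    by (simp add: power2_eq_square algebra_simps)
  have eq: "((2 * a 1) * (?d 1 x * ?d 1 y) + (a 2 + a' 1) * (?d 1 x * ?d 2 y)
      + (a 2 + a' 1) * (?d 2 x * ?d 1 y) + (2 * a' 2) * (?d 2 x * ?d 2 y)
      + ?d 3 x * ?t y + ?t x * ?d 3 y)\<^sup>2
      + (?d 1 x * ?d 1 y + ?d 2 x * ?d 2 y + ?d 3 x * ?d 3 y)\<^sup>2 = 1" if "x \<in> X" "y \<in> X" for x y
  proof -
    have "fst x \<bullet> fst y = ?d 1 x * ?d 1 y + ?d 2 x * ?d 2 y + ?d 3 x * ?d 3 y"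
      by (simp add: inner)
    then show ?thesis
      using skew_equidistant_kernel[OF X that] recip[OF that] by metis
  qed
  obtain c where c: "\<exists>x\<in>X. c x \<noteq> 0" and zero:
    "\<forall>f\<in>{?d 1, ?d 2, ?d 3, ?t}. \<forall>g\<in>{?d 1, ?d 2, ?d 3, ?t}. mom c X f g = 0"
    by (rule moments_vanish_4[OF fin card unit isotropic eq])
  show ?thesis
  proof (rule quad_dependentI[OF c zero])
    fix u :: "(real^3) \<times> (real^3)"
    let ?u = "\<lambda>k. h (fst u) $ k" and ?w = "\<lambda>k. h (snd u) $ k"
    let ?\<alpha> = "[(?u 1 + ?w 1 * a 1 + ?w 2 * a' 1 - ?w 3 * a 3, ?d 1),
      (?u 2 + ?w 1 * a 2 + ?w 2 * a' 2 - ?w 3 * a' 3, ?d 2),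
      (?u 3 + ?w 1 * a 3 + ?w 2 * a' 3, ?d 3), (?w 3, ?t)]"
    show "\<exists>\<alpha>. snd ` set \<alpha> \<subseteq> {?d 1, ?d 2, ?d 3, ?t} \<and>
      (\<forall>x\<in>X. x \<bullet> u = (\<Sum>(a, f)\<leftarrow>\<alpha>. a * f x))"
      by (intro exI[of _ ?\<alpha>]) (simp add: inner_prod_def inner m algebra_simps)
  qed
qed

section \<open>Independence and the bound for skew lines\<close>

text \<open>\<open>a\<close>, \<open>b\<close>, \<open>c\<close> stand for the inner products of
  three unit directions and \<open>p\<close>, \<open>q\<close>, \<open>r\<close> for the reciprocal
  products. Comparing (p q)^2 with p^2 q^2 shows that the Gram determinant of the directions
  vanishes.\<close>

lemma gram_contradiction:
  fixes p q r a b c :: real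
  assumes "p\<^sup>2 = 1 - a\<^sup>2" "q\<^sup>2 = 1 - b\<^sup>2" "r\<^sup>2 = 1 - c\<^sup>2"
    and "p * q = c - a * b" "p * r = b - a * c" "q * r = a - b * c"
    and "a\<^sup>2 < 1" "b\<^sup>2 < 1" "c\<^sup>2 < 1"
  shows False
proof -
  have det: "1 - a\<^sup>2 - b\<^sup>2 - c\<^sup>2 + 2 * a * b * c = 0"
    using assms by algebra
  \<comment> \<open>This is p^2 (q r) = (p q) (p r), multiplied by \<open>a\<close>, with 2 a b c
    eliminated by \<open>det\<close>. The second factors here and in the next identity add up to 2 -
    2 c^2.\<close>
  have "(1 - a\<^sup>2) * (1 + a\<^sup>2 - b\<^sup>2 - c\<^sup>2) = 0"
    using assms(1-6) det by algebra
  moreover have "(1 - b\<^sup>2) * (1 + b\<^sup>2 - a\<^sup>2 - c\<^sup>2) = 0"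
    using assms(1-6) det by algebra
  ultimately have "1 + a\<^sup>2 - b\<^sup>2 - c\<^sup>2 = 0" "1 + b\<^sup>2 - a\<^sup>2 - c\<^sup>2 = 0"
    using assms(7,8) by auto
  then show False
    using assms(9) by linarith
qed

text \<open>The polar form of the quadratic form that vanishes on all lines at distance 1 from the line
  \<open>x\<close>; it is singular at \<open>x\<close> itself.\<close>
definition polar :: "(real^3) \<times> (real^3) \<Rightarrow> (real^3) \<times> (real^3) \<Rightarrow> (real^3) \<times> (real^3) \<Rightarrow> real"
  where "polar x y z = recip x y * recip x z + (fst x \<bullet> fst y) * (fst x \<bullet> fst z) - fst y \<bullet> fst z"

lemma polar_linear:
  "polar x (y + y') z = polar x y z + polar x y' z" "polar x y (z + z') = polar x y z + polar x y z'"
  "polar x (a *\<^sub>R y) z = a * polar x y z" "polar x y (a *\<^sub>R z) = a * polar x y z"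
  by (simp_all add: polar_def recip_add_right recip_scale_right inner_add_left inner_add_right algebra_simps)

lemma polar_commute: "polar x y z = polar x z y"
  by (simp add: polar_def inner_commute mult.commute)

lemma polar_self_left:
  assumes "skew_equidistant X" "x \<in> X"
  shows "polar x x z = 0"
  using recip_self[OF assms] inner_fst_self[OF assms] by (simp add: polar_def)

lemma polar_diagonal:
  assumes "skew_equidistant X" "x \<in> X" "y \<in> X"
  shows "polar x y y = 0"
  using skew_equidistant_kernel[OF assms] inner_fst_self[OF assms(1,3)]
  by (simp add: polar_def power2_eq_square)

text \<open>The quadratic form of \<open>polar x\<close> is singular at \<open>x\<close> and
  vanishes at \<open>y\<close>, \<open>z\<close>, \<open>w\<close>, so evaluating it on the relation
  leaves 2 b c \<open>polar x y z\<close> = 0. By symmetry three polar values vanish, which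
  \<open>gram_contradiction\<close> excludes.\<close>

lemma no_three_nonzero_coefficients:
  assumes X: "skew_equidistant X" and mem: "x \<in> X" "y \<in> X" "z \<in> X" "w \<in> X"
    and distinct: "x \<noteq> y" "x \<noteq> z" "y \<noteq> z"
    and rel: "a *\<^sub>R x + b *\<^sub>R y + c *\<^sub>R z + e *\<^sub>R w = 0"
  shows "a * b * c = 0"
proof (rule ccontr)
  assume nz: "a * b * c \<noteq> 0"
  have key: "2 * (\<alpha> * \<beta>) * polar s t u = 0"
    if "\<gamma> *\<^sub>R s + \<alpha> *\<^sub>R t + \<beta> *\<^sub>R u + e *\<^sub>R w = 0" "s \<in> X" "t \<in> X" "u \<in> X" for s t u \<alpha> \<beta> \<gamma>
  proof -
    have "\<gamma> *\<^sub>R s + \<alpha> *\<^sub>R t + \<beta> *\<^sub>R u = (- e) *\<^sub>R w"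
      using that(1) by (simp add: eq_neg_iff_add_eq_0)
    then have "polar s (\<gamma> *\<^sub>R s + \<alpha> *\<^sub>R t + \<beta> *\<^sub>R u) (\<gamma> *\<^sub>R s + \<alpha> *\<^sub>R t + \<beta> *\<^sub>R u) = e * (e * polar s w w)"
      by (simp only: polar_linear mult.assoc)
    moreover have "polar s s z = 0" "polar s z s = 0" for z
      using polar_self_left[OF X that(2)] polar_commute[of s z s] by simp_all
    ultimately show ?thesis
      unfolding polar_linear polar_commute[of s u t] using polar_diagonal[OF X that(2)] that(3,4) mem(4)
      by simp
  qed
  have "polar x y z = 0"
    using key[of a x b y c z] rel mem nz by simp
  moreover have "polar y x z = 0"
    using key[of b y a x c z] rel mem nz by (simp add: add.commute)
  moreover have "polar z x y = 0"
    using key[of c z a x b y] rel mem nz by (simp add: add.assoc add.left_commute)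
  ultimately have zero: "polar x y z = 0" "polar y x z = 0" "polar z x y = 0"
    by simp_all
  have prod: "recip x y * recip x z = fst y \<bullet> fst z - (fst x \<bullet> fst y) * (fst x \<bullet> fst z)"
    "recip x y * recip y z = fst x \<bullet> fst z - (fst x \<bullet> fst y) * (fst y \<bullet> fst z)"
    "recip x z * recip y z = fst x \<bullet> fst y - (fst x \<bullet> fst z) * (fst y \<bullet> fst z)"
    using zero unfolding polar_def recip_commute[of y x] recip_commute[of z x] recip_commute[of z y]
      inner_commute[of "fst y" "fst x"] inner_commute[of "fst z" "fst x"] inner_commute[of "fst z" "fst y"]
    by simp_all
  have sq: "(recip s t)\<^sup>2 = 1 - (fst s \<bullet> fst t)\<^sup>2" if "s \<in> X" "t \<in> X" for s t
    using skew_equidistant_kernel[OF X that] by simp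
  have lt: "(fst s \<bullet> fst t)\<^sup>2 < 1" if "s \<in> X" "t \<in> X" "s \<noteq> t" for s t
    using X that by (simp add: skew_equidistant_def)
  show False
    by (rule gram_contradiction[OF sq[OF mem(1,2)] sq[OF mem(1,3)] sq[OF mem(2,3)] prod
        lt[OF mem(1,2) distinct(1)] lt[OF mem(1,3) distinct(2)] lt[OF mem(2,3) distinct(3)]])
qed

text \<open>A relation has at most two nonzero terms. Pairing it through \<open>recip\<close> with
  one of the two vectors removes that vector and leaves a nonzero multiple of a nonzero reciprocal
  product.\<close>

lemma independent_4:
  assumes X: "skew_equidistant X" and "T \<subseteq> X" and "card T = 4"
  shows "independent T"
proof -
  have fin: "finite T"
    using assms(3) by (simp add: card_ge_0_finite)
  have "c x = 0" if rel: "(\<Sum>v\<in>T. c v *\<^sub>R v) = 0" and "x \<in> T" for c x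
  proof (rule ccontr)
    assume "c x \<noteq> 0"
    have "card (T - {x}) = 3"
      using assms(3) fin \<open>x \<in> T\<close> by simp
    then obtain y z w where yzw: "T - {x} = {y, z, w}" "y \<noteq> z" "z \<noteq> w" "y \<noteq> w"
      by (auto simp: card_3_iff)
    then have T: "T = {x, y, z, w}" and neq: "x \<noteq> y" "x \<noteq> z" "x \<noteq> w"
      using \<open>x \<in> T\<close> by auto
    then have mem: "x \<in> X" "y \<in> X" "z \<in> X" "w \<in> X"
      using \<open>T \<subseteq> X\<close> by auto
    have rel4: "c x *\<^sub>R x + c y *\<^sub>R y + c z *\<^sub>R z + c w *\<^sub>R w = 0"
      using rel yzw neq unfolding T by (simp add: add.assoc)
    have yz: "c y * c z = 0"
      using no_three_nonzero_coefficients[OF X mem _ _ _ rel4] yzw neq \<open>c x \<noteq> 0\<close> by simp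
    have yw: "c y * c w = 0"
      using no_three_nonzero_coefficients[OF X mem(1,2,4,3), of "c x" "c y" "c w" "c z"] rel4 yzw neq \<open>c x \<noteq> 0\<close>
      by (simp add: ac_simps)
    have zw: "c z * c w = 0"
      using no_three_nonzero_coefficients[OF X mem(1,3,4,2), of "c x" "c z" "c w" "c y"] rel4 yzw neq \<open>c x \<noteq> 0\<close>
      by (simp add: ac_simps)
    have two: False if "c x *\<^sub>R x + b *\<^sub>R t = 0" "t \<in> X" "x \<noteq> t" for b t
    proof -
      have "recip t (c x *\<^sub>R x + b *\<^sub>R t) = 0"
        using that by (simp add: recip_zero_right)
      then show False
        using recip_self[OF X that(2)] recip_nonzero[OF X that(2) mem(1)] that(3) \<open>c x \<noteq> 0\<close>
        by (simp add: recip_add_right recip_scale_right)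
    qed
    show False
      using two[of "c y" y] two[of "c z" z] two[of "c w" w] yz yw zw rel4 mem neq by auto
  qed
  then show ?thesis
    using fin by (auto simp: independent_explicit)
qed

section \<open>Independent conditions on quadrics\<close>

text \<open>Products of the form \<open>v\<close> with any linear form vanish on \<open>T1\<close>,
  so independence of \<open>T2\<close> kills the coefficients there. What is left is a relation on
  \<open>T1\<close>, which its independence kills in turn.\<close>

lemma not_quad_dependent_split:
  fixes T1 T2 :: "'a::euclidean_space set"
  assumes indep: "independent T1" "independent T2"
    and v: "\<And>x. x \<in> T1 \<Longrightarrow> x \<bullet> v = 0" "\<And>x. x \<in> T2 \<Longrightarrow> x \<bullet> v \<noteq> 0"
  shows "\<not> quad_dependent (T1 \<union> T2)"
proof
  assume "quad_dependent (T1 \<union> T2)"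
  then obtain c where nz: "\<exists>x\<in>T1 \<union> T2. c x \<noteq> 0"
    and zero: "\<And>u w. (\<Sum>x\<in>T1 \<union> T2. c x * ((x \<bullet> u) * (x \<bullet> w))) = 0"
    unfolding quad_dependent_def mom_def by blast
  have fin: "finite T1" "finite T2"
    using indep by (auto simp: independent_explicit)
  have disj: "T1 \<inter> T2 = {}"
    using v by fastforce
  have sum: "(\<Sum>x\<in>T1. c x * ((x \<bullet> u) * (x \<bullet> w))) + (\<Sum>x\<in>T2. c x * ((x \<bullet> u) * (x \<bullet> w))) = 0" for u w
    using zero[of u w] by (simp add: sum.union_disjoint fin disj)
  have vanish: "c x * (x \<bullet> u) = 0"
    if "independent T" "\<And>w. (\<Sum>x\<in>T. c x * ((x \<bullet> u) * (x \<bullet> w))) = 0" "x \<in> T" for T u x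
  proof -
    have "(\<Sum>x\<in>T. (c x * (x \<bullet> u)) *\<^sub>R x) \<bullet> w = 0" for w
      using that(2)[of w] by (simp add: inner_sum_left mult.assoc)
    then have "(\<Sum>x\<in>T. (c x * (x \<bullet> u)) *\<^sub>R x) = 0"
      using inner_eq_zero_iff by blast
    then show ?thesis
      by (rule independentD[OF that(1) finiteI_independent[OF that(1)] subset_refl _ that(3)])
  qed
  have 2: "c x = 0" if "x \<in> T2" for x
  proof -
    have "c x * (x \<bullet> v) = 0"
      using sum[of v] v(1) by (intro vanish[OF indep(2) _ that]) simp
    then show ?thesis
      using v(2)[OF that] by simp
  qed
  have 1: "c x = 0" if "x \<in> T1" for x
  proof -
    have "c x * (x \<bullet> x) = 0"
      using sum[of x] 2 by (intro vanish[OF indep(1) _ that]) simp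
    moreover have "x \<noteq> 0"
      using indep(1) that dependent_zero by blast
    ultimately show ?thesis
      by simp
  qed
  show False
    using nz 1 2 by blast
qed

text \<open>The normal vector is chosen inside \<open>U\<close>, so its kernel on \<open>U\<close>
  is a proper subspace containing \<open>span T\<close>; the dimensions then force equality.\<close>

lemma hyperplane_of_subspace:
  fixes U :: "'a::euclidean_space set"
  assumes U: "subspace U" and T: "T \<subseteq> U" "independent T" and dim: "dim U = Suc (card T)"
  obtains v where "\<And>x. x \<in> U \<Longrightarrow> x \<bullet> v = 0 \<longleftrightarrow> x \<in> span T"
proof -
  have dimT: "dim T = card T"
    using T by (simp add: dim_eq_card_independent)
  have sub: "span T \<subseteq> U"
    using T U by (simp add: span_minimal)
  then have "span T \<subset> span U"
    using dim dimT U by (metis dim_span n_not_Suc_n psubsetI span_eq_iff)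
  then obtain v where v: "v \<noteq> 0" "v \<in> span U" "\<And>y. y \<in> span T \<Longrightarrow> orthogonal v y"
    using orthogonal_to_subspace_exists_gen by blast
  let ?K = "{x \<in> U. x \<bullet> v = 0}"
  have K: "subspace ?K"
    using U by (auto simp: subspace_def inner_add_left)
  have "v \<in> U" "v \<notin> ?K"
    using v U by (auto simp: span_eq_iff[THEN iffD2])
  then have "?K \<subset> U"
    by blast
  then have "dim ?K < dim U"
    using dim_psubset[of ?K U] K U by (simp only: span_eq_iff[THEN iffD2])
  moreover have "span T \<subseteq> ?K"
    using sub v(3) by (auto simp: orthogonal_def inner_commute)
  ultimately have "span T = ?K"
    using K dim dimT by (intro subspace_dim_equal) auto
  then show thesis
    by (intro that[of v]) auto
qed

lemma not_quad_dependent_hyperplane: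
  fixes U :: "'a::euclidean_space set"
  assumes "subspace U" "T1 \<subseteq> U" "T2 \<subseteq> U" "independent T1" "independent T2"
    and "T2 \<inter> span T1 = {}" and "dim U = Suc (card T1)"
  shows "\<not> quad_dependent (T1 \<union> T2)"
proof -
  obtain v where v: "\<And>x. x \<in> U \<Longrightarrow> x \<bullet> v = 0 \<longleftrightarrow> x \<in> span T1"
    using hyperplane_of_subspace[of U T1] assms by blast
  show ?thesis
  proof (rule not_quad_dependent_split[OF assms(4,5)])
    show "x \<bullet> v = 0" if "x \<in> T1" for x
      using that v assms(2) span_base by blast
    show "x \<bullet> v \<noteq> 0" if "x \<in> T2" for x
      using that v assms(3,6) by blast
  qed
qed

section \<open>Bounds by the dimension of the span\<close>

text \<open>Split seven vectors as 3 + 4. As any four are independent, the three span a hyperplane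
  that misses the other four, so the seven impose independent conditions, one more than the six
  allowed in dimension 4.\<close>

lemma card_in_dim_4:
  assumes X: "skew_equidistant X" and fin: "finite X" and U: "subspace U" "X \<subseteq> U" "dim U \<le> 4"
  shows "card X \<le> 6"
proof (rule ccontr)
  assume "\<not> ?thesis"
  then obtain Y where Y: "Y \<subseteq> X" "card Y = 7" "finite Y"
    using obtain_subset_with_card_n[of 7 X] by auto
  then obtain T1 where T1: "T1 \<subseteq> Y" "card T1 = 3" "finite T1"
    using obtain_subset_with_card_n[of 3 Y] by auto
  have T2: "card (Y - T1) = 4"
    using Y T1 by (simp add: card_Diff_subset)
  have indep2: "independent (Y - T1)"
    using independent_4[OF X _ T2] Y by blast
  have insert_indep: "independent (insert t T1)" if "t \<in> Y - T1" for t
    using that T1 Y by (intro independent_4[OF X]) auto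
  obtain t where "t \<in> Y - T1"
    using T2 by (metis card.empty equals0I zero_neq_numeral)
  then have indep1: "independent T1"
    using insert_indep independent_mono by blast
  have off: "(Y - T1) \<inter> span T1 = {}"
    using insert_indep by (auto simp: independent_insert)
  have "card (Y - T1) \<le> dim U"
    using Y U indep2 by (intro independent_card_le_dim) auto
  then have dimU: "dim U = 4"
    using T2 U(3) by simp
  \<comment> \<open>The complement of \<open>U\<close> in dimension 6 supplies the two relations
    \<open>r\<close> and \<open>s\<close>.\<close>
  have "dim {y. \<forall>x\<in>U. orthogonal x y} = 2"
    using dim_subspace_orthogonal_to_vectors[OF U(1) subspace_UNIV] dimU by simp
  moreover obtain B where B: "B \<subseteq> {y. \<forall>x\<in>U. orthogonal x y}" "independent B"
    and "card B = dim {y. \<forall>x\<in>U. orthogonal x y}"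
    by (rule basis_exists)
  ultimately have "card B = 2"
    by simp
  then obtain r s where rs: "B = {r, s}" "r \<noteq> s"
    by (auto simp: card_2_iff)
  have "\<alpha> = 0 \<and> \<beta> = 0" if "\<alpha> *\<^sub>R r + \<beta> *\<^sub>R s = 0" for \<alpha> \<beta>
  proof -
    let ?c = "\<lambda>v. if v = r then \<alpha> else \<beta>"
    have "(\<Sum>v\<in>B. ?c v *\<^sub>R v) = 0"
      using that rs by simp
    then have "?c v = 0" if "v \<in> B" for v
      by (rule independentD[OF B(2) finiteI_independent[OF B(2)] subset_refl _ that])
    from this[of r] this[of s] show ?thesis
      using rs by simp
  qed
  then have "quad_dependent Y"
    using B(1) rs Y U(2)
    by (intro quad_dependent_4[OF skew_equidistant_subset[OF X Y(1)], of r s])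
      (auto simp: orthogonal_def)
  then show False
    using not_quad_dependent_hyperplane[of U T1 "Y - T1"] U Y T1 indep1 indep2 off dimU
    by (auto simp: Un_absorb1)
qed

text \<open>Four of ten vectors span a hyperplane containing at most six of them, so four lie off
  it. These 4 + 4 vectors exceed the bound of seven conditions.\<close>

lemma card_in_dim_5:
  assumes X: "skew_equidistant X" and fin: "finite X" and U: "subspace U" "X \<subseteq> U" "dim U \<le> 5"
  shows "card X \<le> 9"
proof (rule ccontr)
  assume big: "\<not> ?thesis"
  then obtain T1 where T1: "T1 \<subseteq> X" "card T1 = 4" "finite T1"
    using obtain_subset_with_card_n[of 4 X] by auto
  have indep1: "independent T1"
    by (rule independent_4[OF X T1(1,2)])
  have "card (X \<inter> span T1) \<le> 6"
    using T1 fin by (intro card_in_dim_4[OF skew_equidistant_subset[OF X]])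
      (auto simp: dim_eq_card_independent[OF indep1])
  then have "4 \<le> card (X - span T1)"
    using big fin card_Diff_subset_Int[of X "span T1"] by simp
  then obtain T2 where T2: "T2 \<subseteq> X - span T1" "card T2 = 4" "finite T2"
    using obtain_subset_with_card_n[of 4 "X - span T1"] by auto
  have indep2: "independent T2"
    using T2 by (intro independent_4[OF X _ T2(2)]) auto
  have disj: "T1 \<inter> T2 = {}"
    using T2 span_superset by blast
  obtain t where t: "t \<in> T2"
    using T2(2) by (metis card.empty equals0I zero_neq_numeral)
  have "independent (insert t T1)"
    using t T2 indep1 by (auto simp: independent_insert)
  then have "card (insert t T1) \<le> dim U"
    using t T1 T2 U by (intro independent_card_le_dim) auto
  moreover have "t \<notin> T1"
    using t disj by blast
  ultimately have dimU: "dim U = 5"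
    using U(3) T1 by simp
  have "dim {y. \<forall>x\<in>U. orthogonal x y} = 1"
    using dim_subspace_orthogonal_to_vectors[OF U(1) subspace_UNIV] dimU by simp
  then have "\<not> {y. \<forall>x\<in>U. orthogonal x y} \<subseteq> {0}"
    unfolding dim_eq_0[symmetric] by simp
  then obtain r where r: "r \<noteq> 0" "\<forall>x\<in>U. orthogonal x r"
    by blast
  have sub: "T1 \<union> T2 \<subseteq> X"
    using T1 T2 by auto
  have "card (T1 \<union> T2) = 8"
    using T1 T2 disj by (simp add: card_Un_disjoint)
  then have "quad_dependent (T1 \<union> T2)"
    using r sub U(2) T1 T2
    by (intro quad_dependent_5[OF skew_equidistant_subset[OF X sub], of r]) (auto simp: orthogonal_def)
  then show False
    using not_quad_dependent_hyperplane[of U T1 T2] U sub T1 T2 indep1 indep2 dimU by auto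
qed

lemma obtain_independent_5:
  assumes X: "skew_equidistant X" and fin: "finite X" and card: "card X > 6"
  obtains T where "T \<subseteq> X" "independent T" "card T = 5"
proof -
  have "\<not> dim X \<le> 4"
    using card_in_dim_4[OF X fin, of "span X"] card span_superset by fastforce
  moreover obtain B where B: "B \<subseteq> X" "independent B" "card B = dim X"
    by (metis basis_exists)
  ultimately have "5 \<le> card B"
    by simp
  then obtain T where "T \<subseteq> B" "card T = 5"
    using obtain_subset_with_card_n by metis
  then show thesis
    using that B independent_mono by blast
qed

text \<open>Five independent vectors span a hyperplane with at most nine of sixteen vectors. The at
  least seven others do not fit into dimension 4, so five of them are independent, and 5 + 5 exceeds
  nine conditions.\<close>

lemma card_skew_equidistant:
  assumes X: "skew_equidistant X" and fin: "finite X"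
  shows "card X \<le> 15"
proof (rule ccontr)
  assume big: "\<not> ?thesis"
  then obtain T1 where T1: "T1 \<subseteq> X" "independent T1" "card T1 = 5"
    using obtain_independent_5[OF X fin] by auto
  have "card (X \<inter> span T1) \<le> 9"
    using T1 fin by (intro card_in_dim_5[OF skew_equidistant_subset[OF X]])
      (auto simp: dim_eq_card_independent)
  then have "6 < card (X - span T1)"
    using big fin card_Diff_subset_Int[of X "span T1"] by simp
  then obtain T2 where T2: "T2 \<subseteq> X - span T1" "independent T2" "card T2 = 5"
    using obtain_independent_5[OF skew_equidistant_subset[OF X], of "X - span T1"] fin by auto
  have sub: "T1 \<union> T2 \<subseteq> X" and disj: "T1 \<inter> T2 = {}" and fin12: "finite T1" "finite T2"
    using T1 T2 span_superset fin finite_subset by blast+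
  have "card (T1 \<union> T2) = 10"
    using T1 T2 disj fin12 by (simp add: card_Un_disjoint)
  then have "quad_dependent (T1 \<union> T2)"
    using fin12 by (intro quad_dependent_6[OF skew_equidistant_subset[OF X sub]]) auto
  then show False
    using not_quad_dependent_hyperplane[of UNIV T1 T2] T1 T2 by auto
qed

section \<open>Lines in space\<close>

definition line :: "real^3 \<Rightarrow> real^3 \<Rightarrow> (real^3) set"
  where "line a d = {a + t *\<^sub>R d | t. True}"

lemma line_uminus: "line a (- d) = line a d"
proof -
  have "a + t *\<^sub>R d \<in> line a (- d)" "a + t *\<^sub>R (- d) \<in> line a d" for t
    unfolding line_def by (auto intro: exI[of _ "- t"])
  then show ?thesis
    unfolding line_def by auto
qed

lemma is_line_unit_direction:
  assumes "is_line L"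
  obtains a d where "norm d = 1" "L = line a d"
proof -
  obtain a v where v: "v \<noteq> 0" "L = line a v"
    using assms by (auto simp: is_line_def line_def)
  have "a + t *\<^sub>R v = a + (t * norm v) *\<^sub>R (v /\<^sub>R norm v)"
    "a + t *\<^sub>R (v /\<^sub>R norm v) = a + (t / norm v) *\<^sub>R v" for t
    using v by (simp_all add: field_simps)
  then have "L = line a (v /\<^sub>R norm v)"
    unfolding v line_def by blast
  then show thesis
    using that[of "v /\<^sub>R norm v" a] v(1) by simp
qed

text \<open>Any other difference of points is \<open>r\<close> plus a vector orthogonal to
  \<open>r\<close>, so by Pythagoras the infimum is attained at \<open>r\<close>.\<close>

lemma line_dist_perpendicular:
  fixes a b d e :: "real^3" and s t :: real
  defines "r \<equiv> (a + s *\<^sub>R d) - (b + t *\<^sub>R e)"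
  assumes "r \<bullet> d = 0" "r \<bullet> e = 0"
  shows "line_dist (line a d) (line b e) = norm r"
  unfolding line_dist_def
proof (rule cInf_eq_minimum)
  show "norm r \<in> {norm (x - y) |x y. x \<in> line a d \<and> y \<in> line b e}"
    unfolding r_def line_def by blast
next
  fix z assume "z \<in> {norm (x - y) |x y. x \<in> line a d \<and> y \<in> line b e}"
  then obtain s' t' where z: "z = norm ((a + s' *\<^sub>R d) - (b + t' *\<^sub>R e))"
    by (auto simp: line_def)
  define q where "q = (s' - s) *\<^sub>R d - (t' - t) *\<^sub>R e"
  have "(a + s' *\<^sub>R d) - (b + t' *\<^sub>R e) = r + q"
    by (simp add: r_def q_def algebra_simps)
  moreover have "r \<bullet> q = 0"
    using assms by (simp add: q_def inner_diff_right)
  then have "(norm (r + q))\<^sup>2 = (norm r)\<^sup>2 + (norm q)\<^sup>2"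
    by (simp add: power2_norm_eq_inner inner_add_left inner_add_right inner_commute)
  then have "(norm r)\<^sup>2 \<le> (norm (r + q))\<^sup>2"
    by simp
  then have "norm r \<le> norm (r + q)"
    by (rule power2_le_imp_le) simp
  ultimately show "norm r \<le> z"
    using z by simp
qed

lemma line_dist_skew:
  fixes a b d e :: "real^3"
  assumes unit: "norm d = 1" "norm e = 1" and skew: "(d \<bullet> e)\<^sup>2 < 1"
    and dist: "line_dist (line a d) (line b e) = 1"
  shows "((a - b) \<bullet> cross3 d e)\<^sup>2 + (d \<bullet> e)\<^sup>2 = 1"
proof -
  define g where "g = d \<bullet> e"
  define w where "w = a - b"
  \<comment> \<open>The parameters of the feet of the common perpendicular, by Cramer's rule with
    determinant \<open>1 - g\<^sup>2\<close>.\<close>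
  define s where "s = (g * (w \<bullet> e) - w \<bullet> d) / (1 - g\<^sup>2)"
  define t where "t = (w \<bullet> e - g * (w \<bullet> d)) / (1 - g\<^sup>2)"
  define r where "r = (a + s *\<^sub>R d) - (b + t *\<^sub>R e)"
  have nz: "1 - g\<^sup>2 \<noteq> 0"
    using skew by (simp add: g_def)
  have de: "d \<bullet> d = 1" "e \<bullet> e = 1"
    using unit by (simp_all add: norm_eq_1)
  have r: "r = w + s *\<^sub>R d - t *\<^sub>R e"
    by (simp add: r_def w_def algebra_simps)
  have st: "s * (1 - g\<^sup>2) = g * (w \<bullet> e) - w \<bullet> d" "t * (1 - g\<^sup>2) = w \<bullet> e - g * (w \<bullet> d)"
    using nz by (simp_all add: s_def t_def)
  have "(1 - g\<^sup>2) * (w \<bullet> d + s - t * g) = 0" "(1 - g\<^sup>2) * (w \<bullet> e + s * g - t) = 0"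
    using st by algebra+
  then have rd: "r \<bullet> d = 0" and re: "r \<bullet> e = 0"
    using nz by (simp_all add: r inner_diff_left inner_add_left de g_def inner_commute[of e d])
  have "norm r = 1"
    using line_dist_perpendicular[of a s d b t e] rd re dist by (simp add: r_def)
  \<comment> \<open>A common perpendicular is parallel to the cross product of the directions, which
    is the equality case of Cauchy-Schwarz.\<close>
  moreover have "cross3 r (cross3 d e) = 0"
    by (simp add: Lagrange rd re)
  ultimately have "(r \<bullet> cross3 d e)\<^sup>2 = (norm (cross3 d e))\<^sup>2"
    using norm_cross[of r "cross3 d e"] by simp
  also have "\<dots> = 1 - (d \<bullet> e)\<^sup>2"
    using unit by (simp add: norm_cross)
  also have "r \<bullet> cross3 d e = (a - b) \<bullet> cross3 d e"
    by (simp add: r w_def inner_diff_left inner_add_left dot_cross_self)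
  finally show ?thesis
    by simp
qed

section \<open>Families containing parallel lines\<close>

lemma unit_inner_power2_le:
  fixes d e :: "real^3"
  assumes "norm d = 1" "norm e = 1"
  shows "(d \<bullet> e)\<^sup>2 \<le> 1"
  using Cauchy_Schwarz_ineq[of d e] assms by (simp add: norm_eq_1)

lemma unit_parallel:
  fixes d e :: "real^3"
  assumes "norm d = 1" "norm e = 1" "(d \<bullet> e)\<^sup>2 = 1"
  shows "e = d \<or> e = - d"
proof -
  have "d \<bullet> d = 1" "e \<bullet> e = 1"
    using assms by (simp_all add: norm_eq_1)
  moreover have "d \<bullet> e = 1 \<or> d \<bullet> e = - 1"
    using assms(3) by (simp add: power2_eq_1_iff)
  ultimately have "(e - d) \<bullet> (e - d) = 0 \<or> (e + d) \<bullet> (e + d) = 0"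
    by (auto simp: inner_diff_left inner_diff_right inner_add_left inner_add_right inner_commute)
  then show ?thesis
    by (auto simp: eq_neg_iff_add_eq_0)
qed

definition perp :: "real^3 \<Rightarrow> real^3 \<Rightarrow> real^3"
  where "perp d w = w - (w \<bullet> d) *\<^sub>R d"

lemma line_dist_parallel:
  assumes "norm d = 1" "d' = d \<or> d' = - d" "d'' = d \<or> d'' = - d"
  shows "line_dist (line a d') (line b d'') = norm (perp d a - perp d b)"
proof -
  have "line_dist (line a d) (line b d) = norm (perp d a - perp d b)"
    using line_dist_perpendicular[of a "- (a \<bullet> d)" d b "- (b \<bullet> d)" d] assms(1)
    by (simp add: perp_def norm_eq_1 inner_diff_left inner_add_left)
  then show ?thesis
    using assms line_uminus by auto
qed

text \<open>Five points in space have a nontrivial affine relation. Summing its weights against the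
  squared distances from \<open>p i\<close> gives a value of \<open>- c i\<close> that is the same
  for all \<open>i\<close>; weights that are equal and sum to 0 vanish.\<close>

lemma card_unit_simplex:
  fixes p :: "'i \<Rightarrow> real^3"
  assumes fin: "finite K" and dist: "\<And>i j. i \<in> K \<Longrightarrow> j \<in> K \<Longrightarrow> i \<noteq> j \<Longrightarrow> norm (p i - p j) = 1"
  shows "card K \<le> 4"
proof (rule ccontr)
  assume "\<not> ?thesis"
  then obtain c where nz: "\<exists>i\<in>K. c i \<noteq> 0" and rel: "(\<Sum>i\<in>K. c i *\<^sub>R (p i, 1 :: real)) = 0"
    using nontrivial_relation[OF fin, of "\<lambda>i. (p i, 1 :: real)"] by auto
  have cp: "(\<Sum>i\<in>K. c i *\<^sub>R p i) = 0" and c: "sum c K = 0"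
    using rel by (auto simp: prod_eq_iff fst_sum snd_sum)
  have "- c i = (\<Sum>j\<in>K. c j * (p j \<bullet> p j))" if "i \<in> K" for i
  proof -
    have "(\<Sum>j\<in>K. c j * (norm (p i - p j))\<^sup>2) = (\<Sum>j\<in>K. c j - (if j = i then c j else 0))"
      using dist that by (intro sum.cong refl) auto
    also have "\<dots> = - c i"
      using c that fin by (simp add: sum_subtractf)
    finally have "- c i = (\<Sum>j\<in>K. c j * (norm (p i - p j))\<^sup>2)"
      by simp
    also have "\<dots> = (\<Sum>j\<in>K. c j * (p i \<bullet> p i) - 2 * (p i \<bullet> (c j *\<^sub>R p j)) + c j * (p j \<bullet> p j))"
      by (intro sum.cong refl)
        (simp add: power2_norm_eq_inner inner_diff_left inner_diff_right inner_commute algebra_simps)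
    also have "\<dots> = sum c K * (p i \<bullet> p i) - 2 * (p i \<bullet> (\<Sum>j\<in>K. c j *\<^sub>R p j)) + (\<Sum>j\<in>K. c j * (p j \<bullet> p j))"
      by (simp only: sum.distrib sum_subtractf sum_distrib_left sum_distrib_right inner_sum_right)
    finally show ?thesis
      by (simp add: cp c)
  qed
  then obtain k where k: "\<And>i. i \<in> K \<Longrightarrow> c i = k"
    by (metis add.inverse_inverse)
  then have "real (card K) * k = 0"
    using c by simp
  then show False
    using nz k fin by auto
qed

text \<open>Projection along the common direction turns the lines into points at mutual distance
  1.\<close>

lemma card_parallel_class:
  assumes fin: "finite K" and unit: "\<And>i. i \<in> K \<Longrightarrow> norm (d i) = 1"
    and parallel: "\<And>i j. i \<in> K \<Longrightarrow> j \<in> K \<Longrightarrow> (d i \<bullet> d j)\<^sup>2 = 1"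
    and dist: "\<And>i j. i \<in> K \<Longrightarrow> j \<in> K \<Longrightarrow> i \<noteq> j \<Longrightarrow> line_dist (line (a i) (d i)) (line (a j) (d j)) = 1"
  shows "card K \<le> 4"
proof (cases "K = {}")
  case False
  then obtain k where k: "k \<in> K"
    by blast
  have "d i = d k \<or> d i = - d k" if "i \<in> K" for i
    using unit_parallel unit parallel k that by blast
  then have "norm (perp (d k) (a i) - perp (d k) (a j)) = 1" if "i \<in> K" "j \<in> K" "i \<noteq> j" for i j
    using line_dist_parallel[OF unit[OF k]] dist that by metis
  then show ?thesis
    by (rule card_unit_simplex[OF fin])
qed simp

lemma coplanar_directions_height:
  fixes a a' b d e :: "real^3"
  assumes unit: "norm d = 1" "norm e = 1" "norm b = 1" and skew: "(d \<bullet> e)\<^sup>2 < 1"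
    and perp: "d \<bullet> b = 0" "e \<bullet> b = 0"
    and dist: "line_dist (line a d) (line a' e) = 1"
  shows "(a \<bullet> b - a' \<bullet> b)\<^sup>2 = 1"
proof -
  let ?x = "cross3 d e"
  \<comment> \<open>For unit \<open>b\<close>, the expansion of
    \<open>b \<times> (b \<times> ?x)\<close> shows that \<open>?x\<close> is a multiple of
    \<open>b\<close>; so the distance is measured along \<open>b\<close>.\<close>
  have "cross3 b ?x = 0"
    using perp by (simp add: Lagrange inner_commute)
  then have "cross3 b (cross3 b ?x) = 0"
    by simp
  then have x: "?x = (b \<bullet> ?x) *\<^sub>R b"
    using Lagrange[of b b ?x] unit(3) by (simp add: norm_eq_1)
  have "((a - a') \<bullet> ?x)\<^sup>2 = 1 - (d \<bullet> e)\<^sup>2"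
    using line_dist_skew[OF unit(1,2) skew dist] by simp
  moreover have "(norm ?x)\<^sup>2 = 1 - (d \<bullet> e)\<^sup>2"
    using unit by (simp add: norm_cross)
  moreover have "(norm ?x)\<^sup>2 = (b \<bullet> ?x)\<^sup>2"
    by (subst x) (simp add: unit)
  moreover have "((a - a') \<bullet> ?x)\<^sup>2 = (b \<bullet> ?x)\<^sup>2 * (a \<bullet> b - a' \<bullet> b)\<^sup>2"
    by (subst x) (simp add: inner_diff_left power_mult_distrib)
  ultimately have "(b \<bullet> ?x)\<^sup>2 * (a \<bullet> b - a' \<bullet> b)\<^sup>2 = (b \<bullet> ?x)\<^sup>2" "(b \<bullet> ?x)\<^sup>2 \<noteq> 0"
    using skew by auto
  then show ?thesis
    by simp
qed

text \<open>Every line skew to the parallel pair is parallel to the plane of the pair and lies at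
  height 1 or -1 over it. Skew lines of equal height would meet, so each height carries one parallel
  class, and with the class of the pair there are three classes of at most four lines.\<close>

lemma card_with_parallel_pair:
  fixes a d :: "nat \<Rightarrow> real^3"
  assumes unit: "\<And>i. i < n \<Longrightarrow> norm (d i) = 1"
    and dist: "\<And>i j. i < n \<Longrightarrow> j < n \<Longrightarrow> i \<noteq> j \<Longrightarrow> line_dist (line (a i) (d i)) (line (a j) (d j)) = 1"
    and pq: "p < n" "q < n" "p \<noteq> q" "(d p \<bullet> d q)\<^sup>2 = 1"
  shows "n \<le> 12"
proof -
  have q: "d q = d p \<or> d q = - d p"
    using unit_parallel unit pq by blast
  define r where "r = perp (d p) (a p) - perp (d p) (a q)"
  have "norm r = 1"
    using line_dist_parallel[of "d p" "d p" "d q"] unit[OF pq(1)] q dist[OF pq(1,2,3)] by (simp add: r_def)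
  have dp: "d p \<bullet> d p = 1"
    using unit[OF pq(1)] by (simp add: norm_eq_1)
  have r: "r = (a p - a q) - ((a p - a q) \<bullet> d p) *\<^sub>R d p"
    by (simp add: r_def perp_def algebra_simps)
  have "r \<bullet> d p = 0"
    by (simp add: r inner_diff_left[of _ _ "d p"] dp)
  \<comment> \<open>The unit normal of the plane through the lines \<open>p\<close> and
    \<open>q\<close>.\<close>
  define b where "b = cross3 r (d p)"
  have "(norm b)\<^sup>2 = 1"
    using \<open>norm r = 1\<close> unit[OF pq(1)] \<open>r \<bullet> d p = 0\<close> by (simp add: b_def norm_cross)
  then have b: "norm b = 1"
    using power2_eq_iff_nonneg[of "norm b" 1] by simp
  have dpb: "d p \<bullet> b = 0"
    by (simp add: b_def dot_cross_self)
  have db: "d k \<bullet> b = 0" if k: "k < n" "(d p \<bullet> d k)\<^sup>2 < 1" for k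
  proof -
    have neq: "p \<noteq> k" "q \<noteq> k"
      using k dp pq(4) by auto
    let ?x = "cross3 (d p) (d k)"
    let ?S = "1 - (d p \<bullet> d k)\<^sup>2"
    have 1: "((a p - a k) \<bullet> ?x)\<^sup>2 = ?S"
      using line_dist_skew[OF unit[OF pq(1)] unit[OF k(1)] k(2) dist[OF pq(1) k(1) neq(1)]] by simp
    have "line_dist (line (a q) (d p)) (line (a k) (d k)) = 1"
      using dist[OF pq(2) k(1) neq(2)] q by (auto simp: line_uminus)
    from line_dist_skew[OF unit[OF pq(1)] unit[OF k(1)] k(2) this]
    have 2: "((a q - a k) \<bullet> ?x)\<^sup>2 = ?S"
      by simp
    have diff: "(a p - a k) \<bullet> ?x - (a q - a k) \<bullet> ?x = r \<bullet> ?x"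
      by (simp add: r inner_diff_left dot_cross_self)
    have "(r \<bullet> ?x)\<^sup>2 \<le> ?S"
      using Cauchy_Schwarz_ineq[of r ?x] \<open>norm r = 1\<close> unit[OF pq(1)] unit[OF k(1)]
      by (simp add: power2_norm_eq_inner[symmetric] norm_cross)
    moreover have "(a p - a k) \<bullet> ?x = (a q - a k) \<bullet> ?x \<or> (a p - a k) \<bullet> ?x = - ((a q - a k) \<bullet> ?x)"
      using 1 2 by (simp add: power2_eq_iff[symmetric])
    \<comment> \<open>If line \<open>k\<close> passed between the two parallel lines, the component
      of the unit vector \<open>r\<close> along the common normal would have length 2.\<close>
    ultimately have "r \<bullet> ?x = 0"
    proof (elim disjE)
      assume "(a p - a k) \<bullet> ?x = - ((a q - a k) \<bullet> ?x)"
      then have "r \<bullet> ?x = - 2 * ((a q - a k) \<bullet> ?x)"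
        using diff by simp
      then have "(r \<bullet> ?x)\<^sup>2 = 4 * ?S"
        using 2 by (simp only: power_mult_distrib) simp
      then show ?thesis
        using \<open>(r \<bullet> ?x)\<^sup>2 \<le> ?S\<close> k(2) by simp
    qed (use diff in simp)
    then show ?thesis
      by (simp add: b_def cross3_simps)
  qed
  have parallel_trans: "(d i \<bullet> d j)\<^sup>2 = 1"
    if "i < n" "j < n" "(d p \<bullet> d i)\<^sup>2 = 1" "(d p \<bullet> d j)\<^sup>2 = 1" for i j
    using unit_parallel[OF unit[OF pq(1)] unit[OF that(1)] that(3)]
      unit_parallel[OF unit[OF pq(1)] unit[OF that(2)] that(4)] dp by auto
  define K where "K \<epsilon> = {k. k < n \<and> (d p \<bullet> d k)\<^sup>2 < 1 \<and> a k \<bullet> b = a p \<bullet> b + \<epsilon>}" for \<epsilon>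
  define K0 where "K0 = {k. k < n \<and> (d p \<bullet> d k)\<^sup>2 = 1}"
  have "card K0 \<le> 4"
    using unit dist parallel_trans by (intro card_parallel_class[of K0 d a]) (auto simp: K0_def)
  have K: "card (K \<epsilon>) \<le> 4" for \<epsilon>
  proof (rule card_parallel_class[of _ d a])
    show "(d i \<bullet> d j)\<^sup>2 = 1" if ij: "i \<in> K \<epsilon>" "j \<in> K \<epsilon>" for i j
    proof (cases "i = j")
      case True
      then show ?thesis
        using ij unit by (simp add: K_def norm_eq_1)
    next
      case False
      have "\<not> (d i \<bullet> d j)\<^sup>2 < 1"
        using coplanar_directions_height[of "d i" "d j" b "a i" "a j"] ij False unit b db dist
        by (auto simp: K_def)
      then show ?thesis
        using unit_inner_power2_le[of "d i" "d j"] unit ij by (auto simp: K_def)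
    qed
  qed (use unit dist in \<open>auto simp: K_def\<close>)
  have "{..<n} \<subseteq> K0 \<union> K 1 \<union> K (- 1)"
  proof
    fix k assume "k \<in> {..<n}"
    then have k: "k < n"
      by simp
    show "k \<in> K0 \<union> K 1 \<union> K (- 1)"
    proof (cases "(d p \<bullet> d k)\<^sup>2 = 1")
      case False
      then have lt: "(d p \<bullet> d k)\<^sup>2 < 1"
        using unit_inner_power2_le[OF unit[OF pq(1)] unit[OF k]] by simp
      then have "p \<noteq> k"
        using dp by auto
      then have "(a p \<bullet> b - a k \<bullet> b)\<^sup>2 = 1"
        by (intro coplanar_directions_height[OF unit[OF pq(1)] unit[OF k] b lt dpb db[OF k lt]]
            dist[OF pq(1) k])
      then show ?thesis
        using k lt by (auto simp: K_def power2_eq_1_iff)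
    qed (use k in \<open>simp add: K0_def\<close>)
  qed
  then have "n \<le> card (K0 \<union> K 1 \<union> K (- 1))"
    using card_mono[of "K0 \<union> K 1 \<union> K (- 1)" "{..<n}"] by (simp add: K_def K0_def)
  also have "\<dots> \<le> card K0 + card (K 1) + card (K (- 1))"
    using card_Un_le[of "K0 \<union> K 1" "K (- 1)"] card_Un_le[of K0 "K 1"] by linarith
  finally show ?thesis
    using K[of 1] K[of "- 1"] \<open>card K0 \<le> 4\<close> by linarith
qed

text \<open>With moments \<open>cross3 (a i) (d i)\<close> the reciprocal product becomes the triple
  product in the distance formula for skew lines. Distinct lines give distinct vectors because no
  two directions agree.\<close>

lemma card_pairwise_skew:
  fixes a d :: "nat \<Rightarrow> real^3"
  assumes unit: "\<And>i. i < n \<Longrightarrow> norm (d i) = 1"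
    and dist: "\<And>i j. i < n \<Longrightarrow> j < n \<Longrightarrow> i \<noteq> j \<Longrightarrow> line_dist (line (a i) (d i)) (line (a j) (d j)) = 1"
    and skew: "\<And>i j. i < n \<Longrightarrow> j < n \<Longrightarrow> i \<noteq> j \<Longrightarrow> (d i \<bullet> d j)\<^sup>2 < 1"
  shows "n \<le> 15"
proof -
  define x where "x i = (d i, cross3 (a i) (d i))" for i
  have recip_x: "recip (x i) (x j) = (a i - a j) \<bullet> cross3 (d i) (d j)" for i j
    by (simp add: recip_def x_def cross3_simps)
  have inj: "inj_on x {..<n}"
  proof (rule inj_onI, rule ccontr)
    fix i j assume ij: "i \<in> {..<n}" "j \<in> {..<n}" "x i = x j" "i \<noteq> j"
    then show False
      using skew[of i j] unit[of j] by (simp add: x_def norm_eq_1)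
  qed
  have "skew_equidistant (x ` {..<n})"
    unfolding skew_equidistant_def
  proof (intro conjI ballI impI; elim imageE)
    fix u i assume "u = x i" "i \<in> {..<n}"
    then show "norm (fst u) = 1" "fst u \<bullet> snd u = 0"
      using unit by (simp_all add: x_def dot_cross_self)
  next
    fix u v i j assume ij: "u \<noteq> v" "u = x i" "i \<in> {..<n}" "v = x j" "j \<in> {..<n}"
    then have "i < n" "j < n" "i \<noteq> j"
      by auto
    then show "(fst u \<bullet> fst v)\<^sup>2 < 1" "(recip u v)\<^sup>2 + (fst u \<bullet> fst v)\<^sup>2 = 1"
      using line_dist_skew[OF unit unit skew dist] skew unfolding ij recip_x by (simp_all add: x_def)
  qed
  then have "card (x ` {..<n}) \<le> 15"
    by (rule card_skew_equidistant) simp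
  then show ?thesis
    by (simp add: card_image[OF inj])
qed

theorem theorem1:
  fixes L :: "nat \<Rightarrow> (real^3) set" and n :: nat
  assumes "\<And>i. i < n \<Longrightarrow> is_line (L i)"
    and "\<And>i j. i < j \<Longrightarrow> j < n \<Longrightarrow> line_dist (L i) (L j) = 1"
  shows "n \<le> 18"
proof -
  have "\<forall>i. \<exists>a d. i < n \<longrightarrow> norm d = 1 \<and> L i = line a d"
    using assms(1) is_line_unit_direction by metis
  then obtain a d where ad: "\<And>i. i < n \<Longrightarrow> norm (d i) = 1" "\<And>i. i < n \<Longrightarrow> L i = line (a i) (d i)"
    by metis
  have sym: "line_dist M N = line_dist N M" for M N
    unfolding line_dist_def by (rule arg_cong[of _ _ Inf]) (auto; metis norm_minus_commute)
  have dist: "line_dist (line (a i) (d i)) (line (a j) (d j)) = 1" if "i < n" "j < n" "i \<noteq> j" for i j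
    using assms(2)[of i j] assms(2)[of j i] sym ad(2) that by (metis linorder_neqE_nat)
  \<comment> \<open>A parallel pair leads to the bound 12, its absence to 15.\<close>
  show ?thesis
  proof (cases "\<exists>p q. p < n \<and> q < n \<and> p \<noteq> q \<and> (d p \<bullet> d q)\<^sup>2 = 1")
    case True
    then obtain p q where "p < n" "q < n" "p \<noteq> q" "(d p \<bullet> d q)\<^sup>2 = 1"
      by blast
    from card_with_parallel_pair[OF ad(1) dist this] show ?thesis
      by simp
  next
    case False
    have skew: "(d i \<bullet> d j)\<^sup>2 < 1" if "i < n" "j < n" "i \<noteq> j" for i j
      using unit_inner_power2_le[OF ad(1)[OF that(1)] ad(1)[OF that(2)]] False that
      by (metis order_le_less)
    have "n \<le> 15"
      by (rule card_pairwise_skew[of n d a, OF ad(1) dist skew])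
    then show ?thesis
      by simp
  qed
qed

end
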